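(* Let $m$ be an odd positive integer, $\gamma_m=\frac{m-1}{2}$, $n\ge1$, let $D\subset\mathbb{C}^n$ be open and symmetric, and let $f\in\mathcal{SR}_h(\Omega_D)$ for some $h\in\{1,\dots,n\}$. Then $\Delta_{m+1,h}^{\gamma_m}f\in\mathcal{AM}_h(\Omega_D)$; namely, $\Delta_{m+1,h}^{\gamma_m}f\in\mathcal{S}_h(\Omega_D)$ and $$\overline{\partial}_{x_h}\Delta_{m+1,h}^{\gamma_m}f=0.$$ Thus the Fueter-Sce map extends to a map $\Delta_{m+1,h}^{\gamma_m}:\mathcal{SR}_h(\Omega_D)\to\mathcal{AM}_h(\Omega_D)$.
   Context: $\mathbb{R}_m$ is the real Clifford algebra generated by $e_1,\dots,e_m$ with $e_ie_j+e_je_i=-2\delta_{ij}$; $\mathbb{R}^{m+1}$ is identified with the paravectors $x_0+\sum_{i=1}^m x_ie_i$; $\mathbb{S}=\{x\in\mathbb{R}^{m+1}:x_0=0,\ \sum_{i=1}^m x_i^2=1\}$. Every $x\in\mathbb{R}^{m+1}$ is $\alpha+J\beta$ with $\alpha\in\mathbb{R}$, $\beta\ge0$, $J\in\mathbb{S}$. One-variable notions. For $D\subset\mathbb{C}$ open and conjugation-invariant, $\Omega_D=\{\alpha+J\beta:\alpha+i\beta\in D,J\in\mathbb{S}\}$. A function $g:\Omega_D\to\mathbb{R}_m$ is slice if $g(\alpha+J\beta)=G_0(\alpha+i\beta)+JG_1(\alpha+i\beta)$ with $G_0,G_1:D\to\mathbb{R}_m$ respectively even and odd in $\beta$; slice regular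 if moreover $G_0,G_1$ are $C^1$ and $\partial_\alpha G_0=\partial_\beta G_1$, $\partial_\beta G_0=-\partial_\alpha G_1$. Several variables. $\{\varepsilon_K\}_{K\subset\{1,\dots,n\}}$ is a basis of $\mathbb{R}^{2^n}$. $D\subset\mathbb{C}^n$ is symmetric if it is invariant under conjugation of each single variable, $z\mapsto\bar z^h=(z_1,\dots,\bar z_h,\dots,z_n)$. $\Omega_D=\{(\alpha_l+J_l\beta_l)_{l=1}^n:(\alpha_l+i\beta_l)_l\in D,\ J_1,\dots,J_n\in\mathbb{S}\}\subset(\mathbb{R}^{m+1})^n$. A stem function is $F=\sum_K\varepsilon_KF_K:D\to\mathbb{R}_m\otimes\mathbb{R}^{2^n}$ with $F_K(\bar z^h)=F_K(z)$ if $h\notin K$, $F_K(\bar z^h)=-F_K(z)$ if $h\in K$. It induces the slice function $f(x)=\sum_KJ_{k_1}\cdots J_{k_p}F_K(z)$ (sum over $K=\{k_1<\dots<k_p\}$), for $x=(\alpha_l+J_l\beta_l)_l$, $z=(\alpha_l+i\beta_l)_l$; $\mathcal{S}(\Omega_D)$ is the set of slice functions. $\mathcal{S}_h(\Omega_D)$ (resp. $\mathcal{SR}_h(\Omega_D)$) is the set of $f\in\mathcal{S}(\Omega_D)$ such that for every $y\in\Omega_D$ the one-variable function $x\mapsto f(y_1,\dots,y_{h-1},x,y_{h+1},\dots,y_n)$ is slice (resp. slice regular) on its natural domain. Writing $x_h=x_{h,0}+\sum_{i=1}^m x_{h,i}e_i$: $\overline{\partial}_{x_h}=\frac12\big(\partial_{x_{h,0}}+\sum_{i=1}^me_i\partial_{x_{h,i}}\big)$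 and $\Delta_{m+1,h}=\sum_{i=0}^m\partial_{x_{h,i}}^2$. $\mathcal{M}_h(\Omega_D)=\{g:\Omega_D\to\mathbb{R}_m:\overline{\partial}_{x_h}g=0\}$ and $\mathcal{AM}_h(\Omega_D)=\mathcal{S}_h(\Omega_D)\cap\mathcal{M}_h(\Omega_D)$. *)

theory Defs
  imports "HOL-Analysis.Analysis"
begin

section \<open>The real Clifford algebra with m = CARD('m) generators\<close>

text \<open>
  An element is the family of its 2^m real coordinates with respect to the basis
  e_A = e_{i1} ... e_{ip}, where A = {i1 < ... < ip} ranges over the subsets of the index type.
  The order on the index type only fixes the order of the factors of e_A.
\<close>

type_synonym 'm clifford = "real ^ ('m set)"

text \<open>
  e_A e_B = sign e_{A \<triangle> B}: sorting the word e_A e_B costs a factor -1 for each pair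
  i \<in> A, j \<in> B with j < i (anticommutation) and for each i \<in> A \<inter> B (from e_i^2 = -1).
\<close>

definition clifford_sign :: "'m::linorder set \<Rightarrow> 'm set \<Rightarrow> real" where
  "clifford_sign A B = (-1) ^ card {(i, j). i \<in> A \<and> j \<in> B \<and> j \<le> i}"

definition cmul :: "('m::{finite,linorder}) clifford \<Rightarrow> 'm clifford \<Rightarrow> 'm clifford"
    (infixl "\<odot>" 70) where
  "a \<odot> b = (\<Sum>A\<in>UNIV. \<Sum>B\<in>UNIV.
     (clifford_sign A B * a $ A * b $ B) *\<^sub>R axis (sym_diff A B) 1)"

definition cunit :: "('m::{finite,linorder}) clifford" where
  "cunit = axis {} 1"

definition cgen :: "'m::{finite,linorder} \<Rightarrow> 'm clifford" where
  "cgen i = axis {i} 1"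

definition cprod_list :: "('m::{finite,linorder}) clifford list \<Rightarrow> 'm clifford" where
  "cprod_list as = foldr (\<odot>) as cunit"

lemma bilinear_cmul: "bilinear (cmul :: ('m::{finite,linorder}) clifford \<Rightarrow> _)"
  unfolding bilinear_def
  by (auto intro!: linearI simp: cmul_def algebra_simps sum.distrib scaleR_sum_right)

lemma cmul_axis: "axis A 1 \<odot> axis B 1 = clifford_sign A B *\<^sub>R axis (sym_diff A B) 1"
proof -
  have ax: "axis X (1::real) $ Y = (if Y = X then 1 else 0)" for X Y :: "'a set"
    by (simp add: axis_def)
  have "(clifford_sign X Y * (if X = A then 1 else 0) * (if Y = B then 1 else 0)) *\<^sub>R axis (sym_diff X Y) (1::real)
      = (if Y = B then if X = A then clifford_sign A B *\<^sub>R axis (sym_diff A B) 1 else 0 else 0)"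
    for X Y by simp
  then show ?thesis unfolding cmul_def ax by simp
qed

lemma clifford_sign_sym_diff_left:
  fixes A B C :: "'m::{finite,linorder} set"
  shows "clifford_sign (sym_diff A B) C = clifford_sign A C * clifford_sign B C"
proof -
  have *: "clifford_sign A C = (\<Prod>i\<in>UNIV. if i \<in> A then (-1) ^ card {j\<in>C. j \<le> i} else 1)"
    for A :: "'m set"
  proof -
    have "{(i, j). i \<in> A \<and> j \<in> C \<and> j \<le> i} = Sigma A (\<lambda>i. {j\<in>C. j \<le> i})" by auto
    then show ?thesis
      by (simp add: clifford_sign_def power_sum prod.If_cases)
  qed
  show ?thesis
    unfolding * prod.distrib[symmetric]
    by (intro prod.cong) (auto simp flip: power_mult_distrib)
qed

lemma clifford_sign_sym_diff_right:
  fixes A B C :: "'m::{finite,linorder} set"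
  shows "clifford_sign A (sym_diff B C) = clifford_sign A B * clifford_sign A C"
proof -
  have *: "clifford_sign A B = (\<Prod>j\<in>UNIV. if j \<in> B then (-1) ^ card {i\<in>A. j \<le> i} else 1)"
    for B :: "'m set"
  proof -
    have "card {(i, j). i \<in> A \<and> j \<in> B \<and> j \<le> i} = card (Sigma B (\<lambda>j. {i\<in>A. j \<le> i}))"
      by (rule bij_betw_same_card[of prod.swap])
         (auto simp: bij_betw_def inj_on_def image_iff)
    then show ?thesis
      by (simp add: clifford_sign_def power_sum prod.If_cases)
  qed
  show ?thesis
    unfolding * prod.distrib[symmetric]
    by (intro prod.cong) (auto simp flip: power_mult_distrib)
qed

lemma cmul_assoc: "(a \<odot> b) \<odot> c = a \<odot> (b \<odot> c)"
  for a b c :: "('m::{finite,linorder}) clifford"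
proof -
  have lin1: "linear (\<lambda>x. x \<odot> y)" and lin2: "linear (\<lambda>x. y \<odot> x)" for y :: "'m clifford"
    using bilinear_cmul unfolding bilinear_def by auto
  have comp: "linear (\<lambda>x. p (q x))" if "linear q" "linear p" for p q :: "'m clifford \<Rightarrow> 'm clifford"
    using linear_compose[OF that] by (simp add: o_def)
  have ext: "p x = q x" if "linear p" "linear q" "\<And>A. p (axis A 1) = q (axis A 1)"
    for p q :: "'m clifford \<Rightarrow> 'm clifford" and x
  proof -
    have "p = q"
      by (rule linear_eq_stdbasis[OF that(1,2)]) (auto simp: Basis_vec_def that(3))
    then show ?thesis by simp
  qed
  have 1: "(axis A 1 \<odot> axis B 1) \<odot> axis C 1 = axis A 1 \<odot> (axis B 1 \<odot> axis C 1)"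
    for A B C :: "'m set"
  proof -
    have "sym_diff (sym_diff A B) C = sym_diff A (sym_diff B C)" by auto
    then show ?thesis
      unfolding cmul_axis linear_scale[OF lin1] linear_scale[OF lin2]
        clifford_sign_sym_diff_left clifford_sign_sym_diff_right by simp
  qed
  have 2: "(axis A 1 \<odot> axis B 1) \<odot> c = axis A 1 \<odot> (axis B 1 \<odot> c)" for A B :: "'m set" and c
    by (rule ext[of "\<lambda>c. (axis A 1 \<odot> axis B 1) \<odot> c" "\<lambda>c. axis A 1 \<odot> (axis B 1 \<odot> c)"])
       (rule lin2 comp[OF lin2 lin2] 1)+
  have 3: "(axis A 1 \<odot> b) \<odot> c = axis A 1 \<odot> (b \<odot> c)" for A :: "'m set" and b c
    by (rule ext[of "\<lambda>b. (axis A 1 \<odot> b) \<odot> c" "\<lambda>b. axis A 1 \<odot> (b \<odot> c)"])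
       (rule comp[OF lin2 lin1] comp[OF lin1 lin2] 2)+
  show ?thesis
    by (rule ext[of "\<lambda>a. (a \<odot> b) \<odot> c" "\<lambda>a. a \<odot> (b \<odot> c)"])
       (rule comp[OF lin1 lin1] lin1 3)+
qed

lemma cgen_anticommute:
  fixes i j :: "'m::{finite,linorder}"
  shows "cgen i \<odot> cgen j + cgen j \<odot> cgen i = (if i = j then -2 else 0) *\<^sub>R cunit"
proof -
  have 1: "clifford_sign {i} {j} = (if j \<le> i then -1 else 1)" for i j :: 'm
  proof -
    have "{(k, l). k \<in> {i} \<and> l \<in> {j} \<and> l \<le> k} = (if j \<le> i then {(i, j)} else {})"
      by auto
    then show ?thesis by (simp add: clifford_sign_def)
  qed
  have "sym_diff {i} {j} = sym_diff {j} {i}" by auto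
  then show ?thesis
    by (cases "i = j")
       (auto simp: cgen_def cunit_def cmul_axis 1 vec_eq_iff)
qed

section \<open>Paravectors\<close>

text \<open>
  The space R^{m+1} is represented as real x real^m, the pair (x0, v) standing for the paravector
  x0 + sum_i v_i e_i; this identification is the map below.
\<close>

type_synonym 'm paravec = "real \<times> (real ^ 'm)"

definition pv :: "('m::{finite,linorder}) paravec \<Rightarrow> 'm clifford" where
  "pv x = fst x *\<^sub>R cunit + (\<Sum>i\<in>UNIV. (snd x $ i) *\<^sub>R cgen i)"

definition imag_sphere :: "('m::finite) paravec set" where
  "imag_sphere = {x. fst x = 0 \<and> (\<Sum>i\<in>UNIV. (snd x $ i)\<^sup>2) = 1}"

text \<open>The paravector Re z + J Im z.\<close>

definition cpoint :: "('m::finite) paravec \<Rightarrow> complex \<Rightarrow> 'm paravec" where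
  "cpoint J z = (Re z, 0) + Im z *\<^sub>R J"

section \<open>Slice functions of one variable\<close>

definition circ1 :: "complex set \<Rightarrow> ('m::finite) paravec set" where
  "circ1 E = {cpoint J z | J z. J \<in> imag_sphere \<and> z \<in> E}"

definition represents1 :: "complex set \<Rightarrow> (complex \<Rightarrow> ('m::{finite,linorder}) clifford) \<Rightarrow>
    (complex \<Rightarrow> 'm clifford) \<Rightarrow> ('m paravec \<Rightarrow> 'm clifford) \<Rightarrow> bool" where
  "represents1 E G0 G1 g \<longleftrightarrow>
     (\<forall>z\<in>E. G0 (cnj z) = G0 z \<and> G1 (cnj z) = - G1 z) \<and>
     (\<forall>z\<in>E. \<forall>J\<in>imag_sphere. g (cpoint J z) = G0 z + pv J \<odot> G1 z)"

definition slice1 :: "complex set \<Rightarrow> (('m::{finite,linorder}) paravec \<Rightarrow> 'm clifford) \<Rightarrow> bool" where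
  "slice1 E g \<longleftrightarrow> (\<exists>G0 G1. represents1 E G0 G1 g)"

definition slice_regular1 ::
    "complex set \<Rightarrow> (('m::{finite,linorder}) paravec \<Rightarrow> 'm clifford) \<Rightarrow> bool" where
  "slice_regular1 E g \<longleftrightarrow>
     (\<exists>G0 G1 (G0' :: complex \<Rightarrow> complex \<Rightarrow>\<^sub>L 'm clifford) (G1' :: complex \<Rightarrow> complex \<Rightarrow>\<^sub>L 'm clifford).
        represents1 E G0 G1 g \<and>
        (\<forall>z\<in>E. (G0 has_derivative blinfun_apply (G0' z)) (at z)) \<and> continuous_on E G0' \<and>
        (\<forall>z\<in>E. (G1 has_derivative blinfun_apply (G1' z)) (at z)) \<and> continuous_on E G1' \<and>
        (\<forall>z\<in>E. blinfun_apply (G0' z) 1 = blinfun_apply (G1' z) \<i> \<and>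
                blinfun_apply (G0' z) \<i> = - blinfun_apply (G1' z) 1))"

section \<open>Slice functions of several variables\<close>

text \<open>The index type 'n of the variables is ordered to fix the order of the products
  J_{k1} ... J_{kp}.\<close>

type_synonym 'n cvecs = "(complex, 'n) vec"
type_synonym ('m, 'n) pvecs = "('m paravec, 'n) vec"

definition upd :: "'a ^ 'n \<Rightarrow> 'n \<Rightarrow> 'a \<Rightarrow> 'a ^ ('n::finite)" where
  "upd y h x = (\<chi> l. if l = h then x else y $ l)"

definition symmetric_dom :: "('n::finite) cvecs set \<Rightarrow> bool" where
  "symmetric_dom D \<longleftrightarrow> (\<forall>z\<in>D. \<forall>h. upd z h (cnj (z $ h)) \<in> D)"

definition circ :: "('n::finite) cvecs set \<Rightarrow> (('m::finite, 'n) pvecs) set" where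
  "circ D = {(\<chi> l. cpoint (J l) (z $ l)) | J z. (\<forall>l. J l \<in> imag_sphere) \<and> z \<in> D}"

text \<open>
  The tensor product of the Clifford algebra with R^{2^n} is the space of families of Clifford
  numbers indexed by the subsets K of 'n, the K-th entry being the coefficient of \<open>\<epsilon>\<^sub>K\<close>.
\<close>

type_synonym ('m, 'n) stemval = "('m clifford, 'n set) vec"

definition stem :: "'n cvecs set \<Rightarrow>
    ('n cvecs \<Rightarrow> ('m::{finite,linorder}, 'n::{finite,linorder}) stemval) \<Rightarrow> bool" where
  "stem D F \<longleftrightarrow> (\<forall>z\<in>D. \<forall>K h.
     F (upd z h (cnj (z $ h))) $ K = (if h \<in> K then - (F z $ K) else F z $ K))"

definition induces :: "'n cvecs set \<Rightarrow>
    ('n cvecs \<Rightarrow> ('m::{finite,linorder}, 'n::{finite,linorder}) stemval) \<Rightarrow>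
    (('m, 'n) pvecs \<Rightarrow> 'm clifford) \<Rightarrow> bool" where
  "induces D F f \<longleftrightarrow> (\<forall>z\<in>D. \<forall>J. (\<forall>l. J l \<in> imag_sphere) \<longrightarrow>
     f (\<chi> l. cpoint (J l) (z $ l)) =
       (\<Sum>K\<in>UNIV. cprod_list (map (\<lambda>k. pv (J k)) (sorted_list_of_set K)) \<odot> (F z $ K)))"

text \<open>
  Functions on \<open>circ D\<close> are total functions of which only the values on \<open>circ D\<close> matter
  (for the derivatives too, as \<open>circ D\<close> is open for D open and symmetric).
\<close>

definition slice_funs :: "('n::{finite,linorder}) cvecs set \<Rightarrow>
    (('m::{finite,linorder}, 'n) pvecs \<Rightarrow> 'm clifford) set" where
  "slice_funs D = {f. \<exists>F. stem D F \<and> induces D F f}"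

text \<open>
  The natural domain of \<open>\<lambda>x. f (upd y h x)\<close> is \<open>{x. upd y h x \<in> circ D}\<close>. As the imaginary sphere is
  non-empty, there is only one conjugation-invariant E with \<open>circ1 E\<close> equal to it.
\<close>

definition section_of :: "'n cvecs set \<Rightarrow> 'n \<Rightarrow> ('m::finite, 'n::finite) pvecs \<Rightarrow>
    complex set \<Rightarrow> bool" where
  "section_of D h y E \<longleftrightarrow>
     open E \<and> cnj ` E = E \<and> circ1 E = {x. upd y h x \<in> circ D}"

definition slice_in :: "'n \<Rightarrow> ('n::{finite,linorder}) cvecs set \<Rightarrow>
    (('m::{finite,linorder}, 'n) pvecs \<Rightarrow> 'm clifford) set" where
  "slice_in h D = {f \<in> slice_funs D. \<forall>y\<in>circ D. \<exists>E.
     section_of D h y E \<and> slice1 E (\<lambda>x. f (upd y h x))}"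

definition slice_regular_in :: "'n \<Rightarrow> ('n::{finite,linorder}) cvecs set \<Rightarrow>
    (('m::{finite,linorder}, 'n) pvecs \<Rightarrow> 'm clifford) set" where
  "slice_regular_in h D = {f \<in> slice_funs D. \<forall>y\<in>circ D. \<exists>E.
     section_of D h y E \<and> slice_regular1 E (\<lambda>x. f (upd y h x))}"

section \<open>Differential operators in the h-th variable\<close>

text \<open>The coordinate directions of a paravector are (1, 0) for x0 and (0, axis i 1) for x_i;
  together they are \<open>Basis\<close>.\<close>

definition along :: "'n \<Rightarrow> 'm paravec \<Rightarrow> (('m::{finite,linorder}, 'n::finite) pvecs \<Rightarrow> 'm clifford) \<Rightarrow>
    ('m, 'n) pvecs \<Rightarrow> real \<Rightarrow> 'm clifford" where
  "along h b g x t = g (upd x h (x $ h + t *\<^sub>R b))"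

definition partial :: "'n \<Rightarrow> 'm paravec \<Rightarrow> (('m::{finite,linorder}, 'n::finite) pvecs \<Rightarrow> 'm clifford) \<Rightarrow>
    ('m, 'n) pvecs \<Rightarrow> 'm clifford" where
  "partial h b g x = vector_derivative (along h b g x) (at 0)"

definition dbar :: "'n \<Rightarrow> (('m::{finite,linorder}, 'n::finite) pvecs \<Rightarrow> 'm clifford) \<Rightarrow>
    ('m, 'n) pvecs \<Rightarrow> 'm clifford" where
  "dbar h g x = (1/2) *\<^sub>R (partial h (1, 0) g x + (\<Sum>i\<in>UNIV. cgen i \<odot> partial h (0, axis i 1) g x))"

definition laplacian :: "'n \<Rightarrow> (('m::{finite,linorder}, 'n::finite) pvecs \<Rightarrow> 'm clifford) \<Rightarrow>
    ('m, 'n) pvecs \<Rightarrow> 'm clifford" where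
  "laplacian h g x = partial h (1, 0) (partial h (1, 0) g) x +
     (\<Sum>i\<in>UNIV. partial h (0, axis i 1) (partial h (0, axis i 1) g) x)"

text \<open>
  \<open>Ck_in h k \<Omega> g\<close>: on \<Omega>, g is of class C^k in its h-th variable, the others being fixed.
  As \<open>vector_derivative\<close> is total, the operators above are meaningful only on functions that are
  regular enough in this sense.
\<close>

fun Ck_in :: "'n \<Rightarrow> nat \<Rightarrow> (('m, 'n) pvecs) set \<Rightarrow>
    (('m::{finite,linorder}, 'n::finite) pvecs \<Rightarrow> 'm clifford) \<Rightarrow> bool" where
  "Ck_in h 0 \<Omega> g \<longleftrightarrow>
     (\<forall>y\<in>\<Omega>. continuous_on {x. upd y h x \<in> \<Omega>} (\<lambda>x. g (upd y h x)))"
| "Ck_in h (Suc k) \<Omega> g \<longleftrightarrow> Ck_in h 0 \<Omega> g \<and>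
     (\<forall>b\<in>Basis. (\<forall>x\<in>\<Omega>. along h b g x differentiable at 0) \<and> Ck_in h k \<Omega> (partial h b g))"

text \<open>Being in the kernel of \<open>dbar\<close> includes being of class C^1 in the h-th variable.\<close>

definition monogenic_in :: "'n \<Rightarrow> ('n::finite) cvecs set \<Rightarrow>
    (('m::{finite,linorder}, 'n) pvecs \<Rightarrow> 'm clifford) set" where
  "monogenic_in h D = {g. Ck_in h 1 (circ D) g \<and> (\<forall>x\<in>circ D. dbar h g x = 0)}"

definition axially_monogenic_in :: "'n \<Rightarrow> ('n::{finite,linorder}) cvecs set \<Rightarrow>
    (('m::{finite,linorder}, 'n) pvecs \<Rightarrow> 'm clifford) set" where
  "axially_monogenic_in h D = slice_in h D \<inter> monogenic_in h D"

end

theory Submission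
  imports Defs "HOL-Complex_Analysis.Cauchy_Integral_Formula"
begin

text \<open>
  Write a paravector as \<open>x\<^sub>0 + v\<close>. In one variable, Cauchy's formula turns a slice regular function
  locally into an integral over \<open>\<zeta>\<close> of the kernel \<open>(\<zeta> - x\<^sub>0 + v) / Q\<close>, where
  \<open>Q = (\<zeta> - x\<^sub>0)\<^sup>2 + |v|\<^sup>2\<close>, also near real points. Direct differentiation gives
  \<open>\<Delta> ((\<zeta> - x\<^sub>0 + v) / Q\<^sup>k) = 2k(2k - 1 - m) (\<zeta> - x\<^sub>0 + v) / Q\<^sup>k\<^sup>+\<^sup>1\<close>, and
  \<open>(\<zeta> - x\<^sub>0 + v) / Q\<^sup>k\<close> is monogenic exactly for \<open>2k = m + 1\<close>, which is reached after
  \<open>(m - 1) / 2\<close> Laplacians.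

  In several variables, being a slice function means that the values at arbitrary imaginary units
  are fixed linear combinations of the values at the units \<open>\<plusminus>J\<close>. Such linear relations survive the
  Laplacian in one variable, because on the plane of any \<open>J\<close> it acts on the functions in question
  by the same first order differential operator, with real coefficients.
\<close>

section \<open>Kernel integrals\<close>

text \<open>The stem components are merely \<open>C^1\<close>, and axially symmetric formulas for
  the Laplacian divide by the distance to the real axis, so neither higher derivatives nor the
  behaviour at real points can be read off the definition. In the kernel, x enters Q through x_0 and
  |v|^2 only, which are polynomials in the coordinates: nothing is singular at v = 0, and
  derivatives of every order come from differentiating under the integral. The given function is the
  case of exponent 1. In several variables, regularity is available only for the restrictions to the
  h-th variable, so a stem function of the iterated Laplacian has to be built from values. Its
  defining relation compares restrictions that are different functions, each on the plane of its own
  unit, with Clifford coefficients on the left. The Laplacian cannot be applied to such a relation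
  directly. A first order operator acting within each plane can, and its real coefficients commute
  with the Clifford ones.\<close>

definition upper :: "('m::finite) paravec \<Rightarrow> complex" where
  "upper x = Complex (fst x) (norm (snd x))"

text \<open>The characteristic polynomial of x at \<zeta>, with roots \<open>upper x\<close> and its
  conjugate. The inner product makes it polynomial in the coordinates of x, whereas
  \<open>upper\<close> involves a norm and is not smooth at real points.\<close>

definition qden :: "complex \<Rightarrow> ('m::finite) paravec \<Rightarrow> complex" where
  "qden \<zeta> x = (\<zeta> - of_real (fst x))\<^sup>2 + of_real (snd x \<bullet> snd x)"

definition off_path :: "(real \<Rightarrow> complex) \<Rightarrow> ('m::finite) paravec set" where
  "off_path p = {x. \<forall>t\<in>{0..1}. qden (p t) x \<noteq> 0}"

text \<open>The factor \<open>p'(t)\<close> of a contour integral along \<open>p\<close> is meant to be part of the weight \<open>w\<close>.\<close>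

definition kint :: "(real \<Rightarrow> complex) \<Rightarrow> (real \<Rightarrow> complex) \<Rightarrow> nat \<Rightarrow> nat \<Rightarrow>
    ('m::finite) paravec \<Rightarrow> real" where
  "kint w p j k x =
     Re (integral {0..1} (\<lambda>t. w t * (p t - of_real (fst x)) ^ j * inverse (qden (p t) x) ^ k))"

lemma continuous_on_upper [continuous_intros]:
  assumes "continuous_on S f" shows "continuous_on S (\<lambda>x. upper (f x))"
  unfolding upper_def complex_eq_iff Complex_eq by (intro continuous_intros assms)

lemma qden_factor: "qden \<zeta> x = (\<zeta> - upper x) * (\<zeta> - cnj (upper x))"
  by (simp add: qden_def upper_def complex_eq_iff power2_eq_square algebra_simps
      flip: power2_norm_eq_inner)

lemma open_off_path:
  assumes "continuous_on {0..1} p"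
  shows "open (off_path p :: ('m::finite) paravec set)"
proof -
  let ?P = "- (p ` {0..1})"
  have eq: "(off_path p :: 'm paravec set) = (upper -` ?P) \<inter> ((\<lambda>x. cnj (upper x)) -` ?P)"
  proof (intro set_eqI)
    fix x :: "'m paravec"
    have "x \<in> off_path p \<longleftrightarrow> (\<forall>t\<in>{0..1}. upper x \<noteq> p t \<and> cnj (upper x) \<noteq> p t)"
      unfolding off_path_def qden_factor mem_Collect_eq mult_eq_0_iff right_minus_eq by (metis (no_types))
    then show "x \<in> off_path p \<longleftrightarrow> x \<in> (upper -` ?P) \<inter> ((\<lambda>x. cnj (upper x)) -` ?P)"
      by blast
  qed
  have "closed (p ` {0..1})"
    by (intro compact_imp_closed compact_continuous_image assms compact_Icc)
  then show ?thesis unfolding eq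
    by (intro open_Int open_vimage open_Compl continuous_intros)
qed

lemma qden_line:
  "qden \<zeta> (x + s *\<^sub>R b) = (\<zeta> - of_real (fst x) - of_real s * of_real (fst b))\<^sup>2
     + (of_real (snd x \<bullet> snd x) + 2 * of_real s * of_real (snd x \<bullet> snd b)
        + (of_real s)\<^sup>2 * of_real (snd b \<bullet> snd b))"
  by (simp add: qden_def inner_simps algebra_simps power2_eq_square inner_commute)

lemma kernel_has_vector_derivative:
  fixes x b :: "('m::finite) paravec"
  assumes "qden \<zeta> (x + s *\<^sub>R b) \<noteq> 0"
  shows "((\<lambda>s. c * (\<zeta> - of_real (fst (x + s *\<^sub>R b))) ^ j * inverse (qden \<zeta> (x + s *\<^sub>R b)) ^ k)
    has_vector_derivative
      (- (of_nat j * of_real (fst b)) * (c * (\<zeta> - of_real (fst (x + s *\<^sub>R b))) ^ (j - 1) * inverse (qden \<zeta> (x + s *\<^sub>R b)) ^ k)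
       + 2 * of_nat k * of_real (fst b) * (c * (\<zeta> - of_real (fst (x + s *\<^sub>R b))) ^ (Suc j) * inverse (qden \<zeta> (x + s *\<^sub>R b)) ^ (Suc k))
       - 2 * of_nat k * of_real (snd (x + s *\<^sub>R b) \<bullet> snd b) * (c * (\<zeta> - of_real (fst (x + s *\<^sub>R b))) ^ j * inverse (qden \<zeta> (x + s *\<^sub>R b)) ^ (Suc k))))
    (at s within S)"
proof -
  \<comment> \<open>Along a line the kernel is a rational function of s. Extending s to complex
    values gives access to field derivatives; the real derivative is then a restriction.\<close>
  define N where "N = (\<lambda>s::complex. \<zeta> - of_real (fst x) - s * of_real (fst b))"
  define M where "M = (\<lambda>s::complex. (N s)\<^sup>2 + (of_real (snd x \<bullet> snd x) + 2 * s * of_real (snd x \<bullet> snd b)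
        + s\<^sup>2 * of_real (snd b \<bullet> snd b)))"
  have M: "M (of_real s) = qden \<zeta> (x + s *\<^sub>R b)" and N: "N (of_real s) = \<zeta> - of_real (fst (x + s *\<^sub>R b))" for s
    by (auto simp: M_def N_def qden_line)
  have dN: "(N has_field_derivative - of_real (fst b)) (at z within T)" for z T
    unfolding N_def by (auto intro!: derivative_eq_intros)
  have dM: "(M has_field_derivative
      (- 2 * N z * of_real (fst b) + 2 * (of_real (snd x \<bullet> snd b) + z * of_real (snd b \<bullet> snd b)))) (at z within T)" for z T
    unfolding M_def by (rule derivative_eq_intros dN refl | simp add: power2_eq_square algebra_simps)+
  have nz: "M (of_real s) \<noteq> 0" using assms M by simp
  have dI: "((\<lambda>z. inverse (M z) ^ k) has_field_derivative
      - of_nat k * (- 2 * N (of_real s) * of_real (fst b) + 2 * (of_real (snd x \<bullet> snd b) + of_real s * of_real (snd b \<bullet> snd b)))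
        * inverse (M (of_real s)) ^ Suc k) (at (of_real s))"
    by (cases k) (rule derivative_eq_intros dM nz refl | simp add: nz divide_inverse algebra_simps)+
  have "((\<lambda>z. c * N z ^ j * inverse (M z) ^ k) has_field_derivative
       (- (of_nat j * of_real (fst b)) * (c * N (of_real s) ^ (j - 1) * inverse (M (of_real s)) ^ k)
       + 2 * of_nat k * of_real (fst b) * (c * N (of_real s) ^ (Suc j) * inverse (M (of_real s)) ^ (Suc k))
       - 2 * of_nat k * of_real (snd (x + s *\<^sub>R b) \<bullet> snd b) * (c * N (of_real s) ^ j * inverse (M (of_real s)) ^ (Suc k))))
     (at (of_real s))"
    by (rule DERIV_cong[OF DERIV_mult[OF DERIV_mult[OF DERIV_const DERIV_power[OF dN]] dI]])
       (simp add: inner_simps algebra_simps)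
  then have "((\<lambda>s. c * N (of_real s) ^ j * inverse (M (of_real s)) ^ k) has_vector_derivative
       (- (of_nat j * of_real (fst b)) * (c * N (of_real s) ^ (j - 1) * inverse (M (of_real s)) ^ k)
       + 2 * of_nat k * of_real (fst b) * (c * N (of_real s) ^ (Suc j) * inverse (M (of_real s)) ^ (Suc k))
       - 2 * of_nat k * of_real (snd (x + s *\<^sub>R b) \<bullet> snd b) * (c * N (of_real s) ^ j * inverse (M (of_real s)) ^ (Suc k))))
     (at s within S)"
    by (rule has_vector_derivative_real_field)
  then show ?thesis unfolding M N .
qed

lemma continuous_on_kernel:
  fixes x :: "'a::topological_space \<Rightarrow> ('m::finite) paravec"
  assumes "continuous_on S c" "continuous_on S \<zeta>" "continuous_on S x"
    and "\<And>y. y \<in> S \<Longrightarrow> qden (\<zeta> y) (x y) \<noteq> 0"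
  shows "continuous_on S (\<lambda>y. c y * (\<zeta> y - of_real (fst (x y))) ^ j * inverse (qden (\<zeta> y) (x y)) ^ k)"
  using assms(4) unfolding qden_def by (intro continuous_intros assms(1-3)) auto

lemma continuous_on_kint:
  fixes p w :: "real \<Rightarrow> complex"
  assumes "continuous_on {0..1} p" "continuous_on {0..1} w"
  shows "continuous_on (off_path p :: ('m::finite) paravec set) (kint w p j k)"
proof -
  have c: "continuous_on (S \<times> {0..1}) (\<lambda>z. p (snd z))" "continuous_on (S \<times> {0..1}) (\<lambda>z. w (snd z))"
    for S :: "'m paravec set"
    by (rule continuous_on_compose2[OF assms(1)] continuous_on_compose2[OF assms(2)];
        auto intro!: continuous_intros)+
  have "continuous_on ((off_path p :: 'm paravec set) \<times> cbox 0 1)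
    (\<lambda>(x, t). w t * (p t - of_real (fst x)) ^ j * inverse (qden (p t) x) ^ k)"
    unfolding case_prod_beta
    by (rule continuous_on_kernel) (use c in \<open>auto intro!: continuous_intros simp: off_path_def\<close>)
  from integral_continuous_on_param[OF this] show ?thesis
    unfolding kint_def by (intro continuous_intros) simp
qed

text \<open>Differentiation under the integral sign, over a parameter ball on which the line stays
  in the open set \<open>off_path p\<close>. With two free exponents the family is closed under
  derivatives up to factors linear in x; for \<open>j = 0\<close> the truncated \<open>j - 1\<close>
  carries the coefficient 0.\<close>

lemma kint_has_vector_derivative:
  fixes x b :: "('m::finite) paravec"
  assumes p: "continuous_on {0..1} p" and w: "continuous_on {0..1} w" and x: "x \<in> off_path p"
  shows "((\<lambda>s. kint w p j k (x + s *\<^sub>R b)) has_vector_derivative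
    (- (real j * fst b) * kint w p (j - 1) k x + 2 * real k * fst b * kint w p (Suc j) (Suc k) x
     - 2 * real k * (snd x \<bullet> snd b) * kint w p j (Suc k) x)) (at 0)"
proof -
  let ?K = "\<lambda>j k s t. w t * (p t - of_real (fst (x + s *\<^sub>R b))) ^ j * inverse (qden (p t) (x + s *\<^sub>R b)) ^ k"
  let ?D = "\<lambda>s t. - (of_nat j * of_real (fst b)) * ?K (j - 1) k s t
     + 2 * of_nat k * of_real (fst b) * ?K (Suc j) (Suc k) s t
     - 2 * of_nat k * of_real (snd (x + s *\<^sub>R b) \<bullet> snd b) * ?K j (Suc k) s t"
  have "open ((\<lambda>s. x + s *\<^sub>R b) -` off_path p)"
    by (intro open_vimage open_off_path p continuous_intros)
  moreover have "0 \<in> (\<lambda>s. x + s *\<^sub>R b) -` off_path p" using x by simp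
  ultimately obtain d where d: "d > 0" "ball 0 d \<subseteq> (\<lambda>s. x + s *\<^sub>R b) -` off_path p"
    unfolding open_contains_ball by blast
  have nz: "qden (p t) (x + s *\<^sub>R b) \<noteq> 0" if "\<bar>s\<bar> < d" "0 \<le> t" "t \<le> 1" for s t
    using d(2) that by (force simp: off_path_def)
  have c: "continuous_on (S \<times> {0..1}) (\<lambda>z. p (snd z))" "continuous_on (S \<times> {0..1}) (\<lambda>z. w (snd z))"
    for S :: "real set"
    by (rule continuous_on_compose2[OF p] continuous_on_compose2[OF w];
        auto intro!: continuous_intros)+
  have cK: "continuous_on (ball 0 d \<times> {0..1}) (\<lambda>z. ?K j k (fst z) (snd z))" for j k
    by (intro continuous_on_kernel continuous_intros c nz) (simp_all add: mem_Times_iff)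
  have iK: "?K j k s integrable_on {0..1}" if "s \<in> ball 0 d" for j k s
    using that by (intro integrable_continuous_real continuous_on_kernel p w continuous_intros nz) auto
  have "((\<lambda>s. integral (cbox 0 1) (?K j k s)) has_vector_derivative integral (cbox 0 1) (?D 0)) (at 0 within ball 0 d)"
  proof (rule leibniz_rule_vector_derivative)
    show "((\<lambda>s. ?K j k s t) has_vector_derivative ?D s t) (at s within ball 0 d)"
      if "s \<in> ball 0 d" "t \<in> cbox 0 1" for s t
      using kernel_has_vector_derivative[OF nz] that by simp
    show "?K j k s integrable_on cbox 0 1" if "s \<in> ball 0 d" for s using iK[OF that] by simp
    show "continuous_on (ball 0 d \<times> cbox 0 1) (\<lambda>(s, t). ?D s t)"
      unfolding case_prod_beta cbox_interval
      by (rule cK continuous_on_add continuous_on_diff continuous_on_mult_left | rule continuous_on_mult continuous_intros)+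
  qed (use d in auto)
  then have 1: "((\<lambda>s. integral {0..1} (?K j k s)) has_vector_derivative integral {0..1} (?D 0)) (at 0)"
    using d(1) by (simp add: at_within_open[of 0 "ball 0 d"])
  have hK: "(?K j k 0 has_integral integral {0..1} (?K j k 0)) {0..1}" for j k
    by (rule integrable_integral, rule iK) (use d(1) in simp)
  have "(?D 0 has_integral (- (of_nat j * of_real (fst b)) * integral {0..1} (?K (j - 1) k 0)
     + 2 * of_nat k * of_real (fst b) * integral {0..1} (?K (Suc j) (Suc k) 0)
     - 2 * of_nat k * of_real (snd (x + 0 *\<^sub>R b) \<bullet> snd b) * integral {0..1} (?K j (Suc k) 0))) {0..1}"
    by (intro has_integral_add has_integral_diff has_integral_mult_right hK)
  from integral_unique[OF this]
  have "integral {0..1} (?D 0) = - (of_nat j * of_real (fst b)) * integral {0..1} (?K (j - 1) k 0)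
     + 2 * of_nat k * of_real (fst b) * integral {0..1} (?K (Suc j) (Suc k) 0)
     - 2 * of_nat k * of_real (snd x \<bullet> snd b) * integral {0..1} (?K j (Suc k) 0)"
    by simp
  then have "Re (integral {0..1} (?D 0)) = - (real j * fst b) * kint w p (j - 1) k x + 2 * real k * fst b * kint w p (Suc j) (Suc k) x
     - 2 * real k * (snd x \<bullet> snd b) * kint w p j (Suc k) x"
    by (simp add: kint_def del: power_Suc)
  with bounded_linear.has_vector_derivative[OF bounded_linear_Re 1] show ?thesis
    unfolding kint_def by simp
qed

text \<open>The identity (\<zeta> - x_0)^2 + |v|^2 = Q cancels one factor 1/Q. This is what
  collapses sums of derivatives into a single kernel.\<close>

lemma kint_reduce:
  assumes p: "continuous_on {0..1} p" and w: "continuous_on {0..1} w" and x: "x \<in> off_path p"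
  shows "kint w p (Suc (Suc j)) (Suc k) x + (snd x \<bullet> snd x) * kint w p j (Suc k) x = kint w p j k x"
proof -
  let ?K = "\<lambda>j k t. w t * (p t - of_real (fst x)) ^ j * inverse (qden (p t) x) ^ k"
  have iK: "?K j k integrable_on {0..1}" for j k
    using x by (intro integrable_continuous_real continuous_on_kernel p w continuous_intros) (auto simp: off_path_def)
  have "?K (Suc (Suc j)) (Suc k) t + of_real (snd x \<bullet> snd x) * ?K j (Suc k) t = ?K j k t" if "t \<in> {0..1}" for t
  proof -
    have "?K (Suc (Suc j)) (Suc k) t + of_real (snd x \<bullet> snd x) * ?K j (Suc k) t
      = ?K j k t * (qden (p t) x * inverse (qden (p t) x))"
      by (simp add: qden_def power2_eq_square algebra_simps)
    then show ?thesis using x that by (simp add: off_path_def)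
  qed
  then have "integral {0..1} (?K j k) = integral {0..1} (\<lambda>t. ?K (Suc (Suc j)) (Suc k) t + of_real (snd x \<bullet> snd x) * ?K j (Suc k) t)"
    by (intro integral_cong) simp
  also have "\<dots> = integral {0..1} (?K (Suc (Suc j)) (Suc k)) + of_real (snd x \<bullet> snd x) * integral {0..1} (?K j (Suc k))"
    by (subst integral_add) (auto intro!: iK integrable_on_mult_right simp del: power_Suc)
  finally show ?thesis by (simp add: kint_def del: power_Suc)
qed

section \<open>Clifford-valued kernels\<close>

interpretation cmul: bounded_bilinear "(\<odot>) :: ('m::{finite,linorder}) clifford \<Rightarrow> _"
  using bilinear_cmul by (simp add: bilinear_conv_bounded_bilinear)

lemma cunit_cmul [simp]: "cunit \<odot> a = a"
proof -
  have "(\<odot>) cunit = (\<lambda>a::'a clifford. a)"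
    by (rule linear_eq_stdbasis[OF bounded_linear.linear[OF cmul.bounded_linear_right] linear_ident])
       (auto simp: Basis_vec_def cunit_def cmul_axis clifford_sign_def)
  then show ?thesis by metis
qed

lemma pv_imag: "pv (0, y) = (\<Sum>i\<in>UNIV. (y $ i) *\<^sub>R cgen i)"
  by (simp add: pv_def)

text \<open>Adding the double sum to its transpose turns the products into anticommutators, of which
  only the diagonal ones survive.\<close>

lemma pv_imag_square: "pv (0, y) \<odot> pv (0, y) = - (y \<bullet> y) *\<^sub>R cunit"
proof -
  have s: "pv (0, y) \<odot> pv (0, y) = (\<Sum>i\<in>UNIV. \<Sum>j\<in>UNIV. (y $ i * y $ j) *\<^sub>R (cgen i \<odot> cgen j))"
    unfolding pv_imag cmul.sum_left
    by (simp add: cmul.sum_right cmul.scaleR_left cmul.scaleR_right scaleR_sum_right mult.commute)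
  also have "\<dots> = (\<Sum>i\<in>UNIV. \<Sum>j\<in>UNIV. (y $ i * y $ j) *\<^sub>R (cgen j \<odot> cgen i))"
    by (subst sum.swap) (rule sum.cong[OF refl], rule sum.cong[OF refl], simp add: mult.commute)
  finally have "2 *\<^sub>R (pv (0, y) \<odot> pv (0, y)) =
      (\<Sum>i\<in>UNIV. \<Sum>j\<in>UNIV. (y $ i * y $ j) *\<^sub>R (cgen i \<odot> cgen j + cgen j \<odot> cgen i))"
    unfolding scaleR_2 scaleR_add_right sum.distrib using s by simp
  also have "\<dots> = (\<Sum>i\<in>UNIV. - (2 * (y $ i * y $ i)) *\<^sub>R cunit)"
  proof (rule sum.cong[OF refl])
    fix i
    have "(y $ i * y $ j) *\<^sub>R (cgen i \<odot> cgen j + cgen j \<odot> cgen i)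
        = (if j = i then - (2 * (y $ i * y $ i)) *\<^sub>R cunit else 0)" for j
      by (simp add: cgen_anticommute)
    then show "(\<Sum>j\<in>UNIV. (y $ i * y $ j) *\<^sub>R (cgen i \<odot> cgen j + cgen j \<odot> cgen i))
        = - (2 * (y $ i * y $ i)) *\<^sub>R cunit" by simp
  qed
  also have "\<dots> = 2 *\<^sub>R (- (y \<bullet> y) *\<^sub>R cunit)"
    by (simp add: inner_vec_def sum_negf sum_distrib_left flip: scaleR_left.sum)
  finally show ?thesis by (simp only: scaleR_cancel_left) simp
qed

lemma pv_imag_cmul_twice: "pv (0, y) \<odot> (pv (0, y) \<odot> c) = - (y \<bullet> y) *\<^sub>R c"
  by (simp add: pv_imag_square cmul.scaleR_left cmul.minus_left flip: cmul_assoc)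

section \<open>Directional derivatives of functions of one paravector\<close>

definition has_pd :: "('m::finite) paravec \<Rightarrow> ('m paravec \<Rightarrow> 'a::real_normed_vector) \<Rightarrow>
    ('m paravec \<Rightarrow> 'a) \<Rightarrow> 'm paravec set \<Rightarrow> bool" where
  "has_pd b u u' V \<longleftrightarrow>
     (\<forall>x\<in>V. ((\<lambda>s. u (x + s *\<^sub>R b)) has_vector_derivative u' x) (at 0))"

definition pd :: "('m::finite) paravec \<Rightarrow> ('m paravec \<Rightarrow> 'a::real_normed_vector) \<Rightarrow> 'm paravec \<Rightarrow> 'a" where
  "pd b u x = vector_derivative (\<lambda>s. u (x + s *\<^sub>R b)) (at 0)"

definition lap1 :: "(('m::finite) paravec \<Rightarrow> 'a::real_normed_vector) \<Rightarrow> 'm paravec \<Rightarrow> 'a" where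
  "lap1 u x = (\<Sum>b\<in>Basis. pd b (pd b u) x)"

definition dbar1 :: "(('m::{finite,linorder}) paravec \<Rightarrow> 'm clifford) \<Rightarrow> 'm paravec \<Rightarrow> 'm clifford" where
  "dbar1 u x = (1/2) *\<^sub>R (pd (1, 0) u x + (\<Sum>i\<in>UNIV. cgen i \<odot> pd (0, axis i 1) u x))"

lemma sum_paravec_Basis:
  "(\<Sum>b\<in>Basis. F b) = F (1::real, 0) + (\<Sum>i\<in>UNIV. F (0, axis i 1 :: real ^ ('m::finite)))"
proof -
  have B: "(Basis :: (real ^ 'm) set) = range (\<lambda>i. axis i 1)" by (auto simp: Basis_vec_def)
  have i: "inj (\<lambda>i::'m. axis i (1::real))" by (auto simp: inj_def axis_eq_axis)
  have "sum F Basis = (\<Sum>b\<in>{(1, 0)}. F b) + (\<Sum>b\<in>(\<lambda>i::'m. (0, axis i 1)) ` UNIV. F b)"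
    unfolding Basis_prod_def B by (subst sum.union_disjoint) (auto simp: image_image)
  then show ?thesis using i by (simp add: sum.reindex inj_def Basis_real_def)
qed

lemma pd_eq: "has_pd b u u' V \<Longrightarrow> x \<in> V \<Longrightarrow> pd b u x = u' x"
  by (auto simp: has_pd_def pd_def intro: vector_derivative_at)

lemma eventually_line:
  assumes "open V" "(x::'a::real_normed_vector) \<in> V"
  shows "eventually (\<lambda>s. x + s *\<^sub>R b \<in> V) (nhds 0)"
proof -
  have "open ((\<lambda>s. x + s *\<^sub>R b) -` V)"
    by (intro open_vimage assms(1) continuous_intros)
  then have "eventually (\<lambda>s. s \<in> (\<lambda>s. x + s *\<^sub>R b) -` V) (nhds 0)"
    using assms(2) by (intro eventually_nhds_in_open) auto
  then show ?thesis by simp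
qed

lemma has_pd_cong:
  assumes "open V" "\<And>x. x \<in> V \<Longrightarrow> u x = v x" "\<And>x. x \<in> V \<Longrightarrow> u' x = v' x"
  shows "has_pd b u u' V \<longleftrightarrow> has_pd b v v' V"
proof -
  have "((\<lambda>s. u (x + s *\<^sub>R b)) has_vector_derivative u' x) (at 0) \<longleftrightarrow>
      ((\<lambda>s. v (x + s *\<^sub>R b)) has_vector_derivative v' x) (at 0)" if "x \<in> V" for x
    unfolding assms(3)[OF that]
    by (intro has_vector_derivative_cong_ev eventually_mono[OF eventually_line[OF assms(1) that, of b]])
       (use assms(2) that in auto)
  then show ?thesis by (auto simp: has_pd_def)
qed

lemma pd_cong:
  assumes "open V" "\<And>x. x \<in> V \<Longrightarrow> u x = v x" "x \<in> V"
  shows "pd b u x = pd b v x"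
  unfolding pd_def
  by (intro vector_derivative_cong_eq eventually_mono[OF eventually_line[OF assms(1,3), of b]])
     (use assms(2) in auto)

lemma pd_pd:
  assumes "open V" "has_pd b u u' V" "has_pd b u' u'' V" "x \<in> V"
  shows "pd b (pd b u) x = u'' x"
  using pd_cong[OF assms(1) pd_eq[OF assms(2)] assms(4)] pd_eq[OF assms(3,4)] by simp

lemma lap1_cong:
  assumes "open V" "\<And>x. x \<in> V \<Longrightarrow> u x = v x" "x \<in> V"
  shows "lap1 u x = lap1 v x"
  unfolding lap1_def by (intro sum.cong refl pd_cong[OF assms(1) pd_cong[OF assms(1,2)] assms(3)])

lemma has_pd_add:
  "has_pd b u u' V \<Longrightarrow> has_pd b v v' V \<Longrightarrow> has_pd b (\<lambda>x. u x + v x) (\<lambda>x. u' x + v' x) V"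
  by (auto simp: has_pd_def intro!: has_vector_derivative_add)

lemma has_pd_pd:
  assumes "open V" "has_pd b u u' V"
  shows "has_pd b u (pd b u) V"
  using assms has_pd_cong[OF assms(1), of u u u' "pd b u" b] pd_eq[OF assms(2)] by simp

lemma has_pd_scaleR:
  "has_pd b u u' V \<Longrightarrow> has_pd b (\<lambda>x. c *\<^sub>R u x) (\<lambda>x. c *\<^sub>R u' x) V"
  by (auto simp: has_pd_def intro!: bounded_linear.has_vector_derivative[OF bounded_linear_scaleR_right])

lemma has_pd_linear_mult:
  assumes "bounded_bilinear B" "bounded_linear l" "has_pd b u u' V"
  shows "has_pd b (\<lambda>x. B (l x) (u x)) (\<lambda>x. B (l x) (u' x) + B (l b) (u x)) V"
  unfolding has_pd_def
proof
  interpret bounded_linear l by fact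
  fix x assume x: "x \<in> V"
  have "((\<lambda>s. l (x + s *\<^sub>R b)) has_vector_derivative l b) (at 0)"
    unfolding add scaleR by (auto intro!: derivative_eq_intros)
  from bounded_bilinear.has_vector_derivative[OF assms(1) this, of "\<lambda>s. u (x + s *\<^sub>R b)" "u' x"]
  show "((\<lambda>s. B (l (x + s *\<^sub>R b)) (u (x + s *\<^sub>R b))) has_vector_derivative B (l x) (u' x) + B (l b) (u x)) (at 0)"
    using assms(3) x by (simp add: has_pd_def)
qed

text \<open>One complex weight per basis element, together with the real part taken in
  \<open>kint\<close>, replaces a Cauchy integral with values in the complexified Clifford
  algebra.\<close>

definition kvec :: "(('m::{finite,linorder}) set \<Rightarrow> real \<Rightarrow> complex) \<Rightarrow> (real \<Rightarrow> complex) \<Rightarrow> nat \<Rightarrow> nat \<Rightarrow>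
    'm paravec \<Rightarrow> 'm clifford" where
  "kvec W p j k x = (\<Sum>A\<in>UNIV. kint (W A) p j k x *\<^sub>R axis A 1)"

text \<open>The integral of (\<zeta> - x_0 + v) / Q^k: the Clifford factor v is taken out of the
  integral and stays on the left.\<close>

definition kslice :: "(('m::{finite,linorder}) set \<Rightarrow> real \<Rightarrow> complex) \<Rightarrow> (real \<Rightarrow> complex) \<Rightarrow> nat \<Rightarrow>
    'm paravec \<Rightarrow> 'm clifford" where
  "kslice W p k x = kvec W p 1 k x + pv (0, snd x) \<odot> kvec W p 0 k x"

lemma bounded_linear_pv_snd: "bounded_linear (\<lambda>x :: ('m::{finite,linorder}) paravec. pv (0, snd x))"
  unfolding pv_imag linear_conv_bounded_linear[symmetric]
  by (auto intro!: linearI simp: algebra_simps sum.distrib scaleR_sum_right)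

lemma has_pd_pv_cmul:
  assumes "has_pd b u u' S"
  shows "has_pd b (\<lambda>x. pv (0, snd x) \<odot> u x) (\<lambda>x. pv (0, snd x) \<odot> u' x + pv (0, snd b) \<odot> u x) S"
  by (rule has_pd_linear_mult[OF cmul.bounded_bilinear_axioms bounded_linear_pv_snd assms])

lemma has_pd_cmul: "has_pd b u u' S \<Longrightarrow> has_pd b (\<lambda>x. c \<odot> u x) (\<lambda>x. c \<odot> u' x) S"
  by (auto simp: has_pd_def intro!: bounded_linear.has_vector_derivative[OF cmul.bounded_linear_right])

lemma sum_cgen_cmul: "(\<Sum>i\<in>UNIV. cgen i \<odot> ((y $ i) *\<^sub>R c)) = pv (0, y) \<odot> c"
  by (simp add: pv_imag cmul.sum_left cmul.scaleR_left cmul.scaleR_right)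

lemma pv_axis: "pv (0, axis i 1) = cgen i"
proof -
  have "(axis i 1 $ j) *\<^sub>R cgen j = (if j = i then cgen i else 0)" for j
    by (simp add: axis_def)
  then show ?thesis by (simp add: pv_imag)
qed

section \<open>Laplacian and Cauchy-Riemann operator on the kernel integrals\<close>

context
  fixes W :: "('m::{finite,linorder}) set \<Rightarrow> real \<Rightarrow> complex" and p :: "real \<Rightarrow> complex"
  assumes p: "continuous_on {0..1} p" and W: "\<And>A. continuous_on {0..1} (W A)"
begin

private abbreviation "V \<equiv> off_path p :: 'm paravec set"
private abbreviation "K \<equiv> kvec W p"

lemma continuous_on_kvec: "continuous_on V (K j k)"
  unfolding kvec_def by (intro continuous_intros continuous_on_kint p W)

lemma kvec_reduce:
  "x \<in> V \<Longrightarrow> K (Suc (Suc j)) (Suc k) x + (snd x \<bullet> snd x) *\<^sub>R K j (Suc k) x = K j k x"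
  using kint_reduce[OF p W, of x]
  by (simp add: kvec_def scaleR_sum_right flip: sum.distrib scaleR_add_left)

lemma has_pd_kvec:
  "has_pd b (K j k) (\<lambda>x. - (real j * fst b) *\<^sub>R K (j - 1) k x + (2 * real k * fst b) *\<^sub>R K (Suc j) (Suc k) x
     + (- 2 * real k) *\<^sub>R ((snd x \<bullet> snd b) *\<^sub>R K j (Suc k) x)) V"
  unfolding has_pd_def
proof
  fix x assume x: "x \<in> V"
  have "((\<lambda>s. K j k (x + s *\<^sub>R b)) has_vector_derivative
     (\<Sum>A\<in>UNIV. (- (real j * fst b) * kint (W A) p (j - 1) k x + 2 * real k * fst b * kint (W A) p (Suc j) (Suc k) x
     - 2 * real k * (snd x \<bullet> snd b) * kint (W A) p j (Suc k) x) *\<^sub>R axis A 1)) (at 0)"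
    unfolding kvec_def
    by (intro has_vector_derivative_sum
        bounded_linear.has_vector_derivative[OF bounded_linear_scaleR_left] kint_has_vector_derivative p W x)
  then show "((\<lambda>s. K j k (x + s *\<^sub>R b)) has_vector_derivative
      - (real j * fst b) *\<^sub>R K (j - 1) k x + (2 * real k * fst b) *\<^sub>R K (Suc j) (Suc k) x
     + (- 2 * real k) *\<^sub>R ((snd x \<bullet> snd b) *\<^sub>R K j (Suc k) x)) (at 0)"
    by (simp add: kvec_def scaleR_sum_right sum.distrib sum_subtractf algebra_simps sum_negf)
qed

lemma has_pd_kvec_real: "has_pd (1, 0) (K j k) (\<lambda>x. - real j *\<^sub>R K (j - 1) k x + (2 * real k) *\<^sub>R K (Suc j) (Suc k) x) V"
  using has_pd_kvec[of "(1, 0)" j k] by simp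

lemma has_pd_kvec_imag: "has_pd (0, y) (K j k) (\<lambda>x. (- 2 * real k) *\<^sub>R ((snd x \<bullet> y) *\<^sub>R K j (Suc k) x)) V"
  using has_pd_kvec[of "(0, y)" j k] by simp

lemma pd_pd_kvec_real:
  assumes "x \<in> V"
  shows "pd (1, 0) (pd (1, 0) (K j k)) x =
    - real j *\<^sub>R (- real (j - 1) *\<^sub>R K (j - 2) k x + (2 * real k) *\<^sub>R K (Suc (j - 1)) (Suc k) x)
    + (2 * real k) *\<^sub>R (- real (Suc j) *\<^sub>R K j (Suc k) x + (2 * real (Suc k)) *\<^sub>R K (Suc (Suc j)) (Suc (Suc k)) x)"
  using pd_pd[OF open_off_path[OF p] has_pd_kvec_real
      has_pd_add[OF has_pd_scaleR[OF has_pd_kvec_real] has_pd_scaleR[OF has_pd_kvec_real]] assms, of j k]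
  by (simp add: numeral_2_eq_2)

lemma pd_pd_kvec_imag:
  assumes "x \<in> V"
  shows "pd (0, y) (pd (0, y) (K j k)) x =
    (4 * real k * real (Suc k) * (snd x \<bullet> y)\<^sup>2) *\<^sub>R K j (Suc (Suc k)) x - (2 * real k * (y \<bullet> y)) *\<^sub>R K j (Suc k) x"
proof -
  have "bounded_linear (\<lambda>x::'m paravec. snd x \<bullet> y)"
    by (intro bounded_linear_compose[OF bounded_linear_inner_left] bounded_linear_snd)
  from has_pd_scaleR[OF has_pd_linear_mult[OF bounded_bilinear_scaleR this has_pd_kvec_imag]]
  have "has_pd (0, y) (\<lambda>x. (- 2 * real k) *\<^sub>R ((snd x \<bullet> y) *\<^sub>R K j (Suc k) x))
    (\<lambda>x. (- 2 * real k) *\<^sub>R ((snd x \<bullet> y) *\<^sub>R (- 2 * real (Suc k)) *\<^sub>R (snd x \<bullet> y) *\<^sub>R K j (Suc (Suc k)) x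
       + (snd (0::real, y) \<bullet> y) *\<^sub>R K j (Suc k) x)) V" .
  from pd_pd[OF open_off_path[OF p] has_pd_kvec_imag this assms] show ?thesis
    by (simp add: algebra_simps power2_eq_square)
qed

lemma sum_pd_pd_kvec_imag:
  assumes "x \<in> V"
  shows "(\<Sum>i\<in>UNIV. pd (0, axis i 1) (pd (0, axis i 1) (K j k)) x) =
    (4 * real k * real (Suc k)) *\<^sub>R ((snd x \<bullet> snd x) *\<^sub>R K j (Suc (Suc k)) x)
    - (2 * real k * CARD('m)) *\<^sub>R K j (Suc k) x"
proof -
  have "(\<Sum>i\<in>UNIV. pd (0, axis i 1) (pd (0, axis i 1) (K j k)) x) =
    (\<Sum>i\<in>UNIV. (4 * real k * real (Suc k)) *\<^sub>R ((snd x $ i)\<^sup>2 *\<^sub>R K j (Suc (Suc k)) x)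
      - (2 * real k) *\<^sub>R K j (Suc k) x)"
    by (simp add: pd_pd_kvec_imag[OF assms] inner_axis)
  also have "\<dots> = (4 * real k * real (Suc k)) *\<^sub>R ((\<Sum>i\<in>UNIV. (snd x $ i)\<^sup>2) *\<^sub>R K j (Suc (Suc k)) x)
      - (\<Sum>i\<in>(UNIV::'m set). 2 * real k) *\<^sub>R K j (Suc k) x"
    unfolding sum_subtractf scaleR_left.sum scaleR_sum_right ..
  finally show ?thesis by (simp add: inner_vec_def power2_eq_square mult_ac)
qed

text \<open>The second derivatives yield (\<zeta> - x_0)^2 / Q^(k+2) in the real direction and |v|^2
  / Q^(k+2) in the imaginary ones, both with the factor 4k(k+1), so \<open>kvec_reduce\<close>
  merges them into 1/Q^(k+1).\<close>

lemma lap1_kvec_even: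
  assumes "x \<in> V"
  shows "lap1 (K 0 k) x = (2 * real k * (2 * real k + 1 - CARD('m))) *\<^sub>R K 0 (Suc k) x"
proof -
  have "lap1 (K 0 k) x = (4 * real k * real (Suc k)) *\<^sub>R
      (K (Suc (Suc 0)) (Suc (Suc k)) x + (snd x \<bullet> snd x) *\<^sub>R K 0 (Suc (Suc k)) x)
      - (2 * real k * (1 + CARD('m))) *\<^sub>R K 0 (Suc k) x"
    unfolding lap1_def sum_paravec_Basis sum_pd_pd_kvec_imag[OF assms] pd_pd_kvec_real[OF assms]
    by (simp add: vec_eq_iff algebra_simps)
  then show ?thesis unfolding kvec_reduce[OF assms]
    by (simp add: vec_eq_iff algebra_simps)
qed

lemma lap1_kvec_odd:
  assumes "x \<in> V"
  shows "lap1 (K 1 k) x = (2 * real k * (2 * real k - 1 - CARD('m))) *\<^sub>R K 1 (Suc k) x"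
proof -
  have "lap1 (K 1 k) x = (4 * real k * real (Suc k)) *\<^sub>R
      (K (Suc (Suc 1)) (Suc (Suc k)) x + (snd x \<bullet> snd x) *\<^sub>R K 1 (Suc (Suc k)) x)
      - (2 * real k * (3 + CARD('m))) *\<^sub>R K 1 (Suc k) x"
    unfolding lap1_def sum_paravec_Basis sum_pd_pd_kvec_imag[OF assms] pd_pd_kvec_real[OF assms]
    by (simp add: vec_eq_iff algebra_simps)
  then show ?thesis unfolding kvec_reduce[OF assms]
    by (simp add: vec_eq_iff algebra_simps)
qed

lemma has_pd_pd_kvec: "has_pd b (pd b (K j k)) (pd b (pd b (K j k))) V"
proof -
  have l: "bounded_linear (\<lambda>x::'m paravec. snd x \<bullet> snd b)"
    by (intro bounded_linear_compose[OF bounded_linear_inner_left] bounded_linear_snd)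
  note d = has_pd_add[OF has_pd_add[OF has_pd_scaleR[OF has_pd_kvec] has_pd_scaleR[OF has_pd_kvec]]
      has_pd_scaleR[OF has_pd_linear_mult[OF bounded_bilinear_scaleR l has_pd_kvec]]]
  show ?thesis
    by (rule has_pd_pd[OF open_off_path[OF p]], subst has_pd_cong[OF open_off_path[OF p] pd_eq[OF has_pd_kvec] refl], assumption, rule d)
qed

lemma has_pd_kslice:
  "has_pd b (kslice W p k)
     (\<lambda>x. pd b (K 1 k) x + (pv (0, snd x) \<odot> pd b (K 0 k) x + pv (0, snd b) \<odot> K 0 k x)) V"
  unfolding kslice_def
  by (intro has_pd_add has_pd_pv_cmul has_pd_pd[OF open_off_path[OF p] has_pd_kvec])

text \<open>The two parts of the kernel have different Laplacian factors. The product rule for v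
  times the even part adds a cross term contributing -4k, and 2k(2k + 1 - m) - 4k = 2k(2k - 1 - m)
  is exactly the factor of the odd part.\<close>

lemma lap1_kslice:
  assumes "x \<in> V"
  shows "lap1 (kslice W p k) x = (2 * real k * (2 * real k - 1 - CARD('m))) *\<^sub>R kslice W p (Suc k) x"
proof -
  have "pd b (pd b (kslice W p k)) x = pd b (pd b (K 1 k)) x + pv (0, snd x) \<odot> pd b (pd b (K 0 k)) x
      + 2 *\<^sub>R (pv (0, snd b) \<odot> pd b (K 0 k) x)" for b
    using pd_pd[OF open_off_path[OF p] has_pd_kslice has_pd_add[OF has_pd_pd_kvec
        has_pd_add[OF has_pd_pv_cmul[OF has_pd_pd_kvec] has_pd_cmul[OF has_pd_pd[OF open_off_path[OF p] has_pd_kvec]]]] assms, of b k]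
    by (simp add: scaleR_2)
  then have "lap1 (kslice W p k) x = lap1 (K 1 k) x + pv (0, snd x) \<odot> lap1 (K 0 k) x
      + 2 *\<^sub>R (\<Sum>b\<in>Basis. pv (0, snd b) \<odot> pd b (K 0 k) x)"
    by (simp add: lap1_def sum.distrib cmul.sum_right scaleR_sum_right)
  also have "(\<Sum>b\<in>Basis. pv (0, snd b) \<odot> pd b (K 0 k) x) =
      (\<Sum>i\<in>UNIV. cgen i \<odot> ((snd x $ i) *\<^sub>R ((- 2 * real k) *\<^sub>R K 0 (Suc k) x)))"
    unfolding sum_paravec_Basis pd_eq[OF has_pd_kvec_imag assms]
    by (simp add: pv_axis inner_axis pv_def[of "(0, 0)"] cmul.zero_left mult.commute)
  also have "\<dots> = pv (0, snd x) \<odot> ((- 2 * real k) *\<^sub>R K 0 (Suc k) x)"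
    by (rule sum_cgen_cmul)
  finally show ?thesis
    unfolding lap1_kvec_even[OF assms] lap1_kvec_odd[OF assms] kslice_def cmul.scaleR_right
    by (simp add: vec_eq_iff algebra_simps)
qed

text \<open>The terms containing v cancel between the real and the imaginary directions. By
  \<open>kvec_reduce\<close> the rest is (2k - 1 - m) times the even kernel: -1 comes from the
  derivative of \<zeta> - x_0, and -m from e_i e_i = -1 in each imaginary direction.\<close>

lemma dbar1_kslice:
  assumes "x \<in> V" "2 * real k = 1 + CARD('m)"
  shows "dbar1 (kslice W p k) x = 0"
proof -
  have re: "pd (1, 0) (kslice W p k) x = (2 * real k) *\<^sub>R K (Suc 1) (Suc k) x - K 0 k x
      + (2 * real k) *\<^sub>R (pv (0, snd x) \<odot> K 1 (Suc k) x)"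
    unfolding pd_eq[OF has_pd_kslice assms(1)] pd_eq[OF has_pd_kvec_real assms(1)]
    by (simp add: pv_def[of "(0, 0)"] cmul.scaleR_right cmul.zero_left)
  have im: "cgen i \<odot> pd (0, axis i 1) (kslice W p k) x =
      (- 2 * real k) *\<^sub>R (cgen i \<odot> ((snd x $ i) *\<^sub>R (K 1 (Suc k) x + pv (0, snd x) \<odot> K 0 (Suc k) x)))
      - K 0 k x" for i
    using pv_imag_cmul_twice[of "axis i 1" "K 0 k x"]
    unfolding pd_eq[OF has_pd_kslice assms(1)] pd_eq[OF has_pd_kvec_imag assms(1)]
    by (simp add: pv_axis inner_axis cmul.scaleR_right cmul.add_right cmul.diff_right cmul.minus_right scaleR_add_right mult.commute)
  have "(\<Sum>i\<in>UNIV. cgen i \<odot> pd (0, axis i 1) (kslice W p k) x) =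
      (- 2 * real k) *\<^sub>R (pv (0, snd x) \<odot> (K 1 (Suc k) x + pv (0, snd x) \<odot> K 0 (Suc k) x))
      - real CARD('m) *\<^sub>R K 0 k x"
    unfolding im sum_subtractf scaleR_sum_right[symmetric] sum_cgen_cmul sum_constant_scaleR ..
  also have "\<dots> = (2 * real k) *\<^sub>R ((snd x \<bullet> snd x) *\<^sub>R K 0 (Suc k) x)
      - (2 * real k) *\<^sub>R (pv (0, snd x) \<odot> K 1 (Suc k) x) - real CARD('m) *\<^sub>R K 0 k x"
    by (simp add: cmul.add_right pv_imag_cmul_twice algebra_simps)
  finally have "2 *\<^sub>R dbar1 (kslice W p k) x = (2 * real k) *\<^sub>R (K (Suc (Suc 0)) (Suc k) x + (snd x \<bullet> snd x) *\<^sub>R K 0 (Suc k) x)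
      - (1 + real CARD('m)) *\<^sub>R K 0 k x"
    unfolding dbar1_def re by (simp add: algebra_simps)
  then show ?thesis unfolding kvec_reduce[OF assms(1)] assms(2) by simp
qed

end

text \<open>A set of explicit functions that is closed under partial derivatives; membership therefore
  gives smoothness of every order.\<close>

inductive_set kalg :: "(('m::{finite,linorder}) set \<Rightarrow> real \<Rightarrow> complex) \<Rightarrow> (real \<Rightarrow> complex) \<Rightarrow>
    ('m paravec \<Rightarrow> 'm clifford) set" for W p where
  kvec: "kvec W p j k \<in> kalg W p"
| linear: "u \<in> kalg W p \<Longrightarrow> bounded_linear l \<Longrightarrow> (\<lambda>x. l x *\<^sub>R u x) \<in> kalg W p"
| cmul: "u \<in> kalg W p \<Longrightarrow> (\<lambda>x. c \<odot> u x) \<in> kalg W p"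
| add: "u \<in> kalg W p \<Longrightarrow> v \<in> kalg W p \<Longrightarrow> (\<lambda>x. u x + v x) \<in> kalg W p"

lemma kalg_scaleR:
  assumes "u \<in> kalg W p" shows "(\<lambda>x. c *\<^sub>R u x) \<in> kalg W p"
  using kalg.cmul[OF assms, of "c *\<^sub>R cunit"] by (simp add: cmul.scaleR_left)

lemma kalg_zero: "(\<lambda>x. 0) \<in> kalg W p"
  using kalg_scaleR[OF kalg.kvec, of 0] by simp

lemma kalg_sum:
  assumes "finite I" "\<And>i. i \<in> I \<Longrightarrow> u i \<in> kalg W p"
  shows "(\<lambda>x. \<Sum>i\<in>I. u i x) \<in> kalg W p"
  using assms by (induction I rule: finite_induct) (auto intro: kalg_zero kalg.add)

text \<open>Expanding v in the generators reduces its left multiplication to real linear factors and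
  constant Clifford factors.\<close>

lemma kslice_in_kalg: "kslice W p k \<in> kalg W p"
proof -
  have l: "bounded_linear (\<lambda>x::'a paravec. snd x $ i)" for i
    by (intro bounded_linear_compose[OF bounded_linear_vec_nth] bounded_linear_snd)
  show ?thesis
    unfolding kslice_def pv_imag cmul.sum_left cmul.scaleR_left
    by (intro kalg.add kalg.kvec kalg_sum kalg.linear kalg.cmul l finite)
qed

lemma continuous_on_kalg:
  assumes "u \<in> kalg W p" "continuous_on {0..1} p" "\<And>A. continuous_on {0..1} (W A)"
  shows "continuous_on (off_path p) u"
  using assms(1)
proof induction
  case (linear u l)
  then show ?case by (intro continuous_on_scaleR[OF linear_continuous_on])
next
  case (cmul u c)
  then show ?case by (intro bounded_linear.continuous_on[OF cmul.bounded_linear_right])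
qed (auto intro: continuous_on_kvec[OF assms(2,3)] continuous_on_add)

lemma kalg_has_pd:
  assumes "u \<in> kalg W p" "continuous_on {0..1} p" "\<And>A. continuous_on {0..1} (W A)"
  shows "\<exists>u'\<in>kalg W p. has_pd b u u' (off_path p)"
  using assms(1)
proof induction
  case (kvec j k)
  have l: "bounded_linear (\<lambda>x::'a paravec. snd x \<bullet> snd b)"
    by (intro bounded_linear_compose[OF bounded_linear_inner_left] bounded_linear_snd)
  show ?case
    by (rule bexI, rule has_pd_kvec, rule assms(2), rule assms(3))
       (intro kalg.add kalg_scaleR kalg.linear kalg.kvec l)
next
  case (linear u l)
  then obtain u' where "u' \<in> kalg W p" "has_pd b u u' (off_path p)" by blast
  then show ?case
    by - (rule bexI, rule has_pd_linear_mult[OF bounded_bilinear_scaleR linear(2)], assumption,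
      intro kalg.add kalg.linear kalg_scaleR linear)
next
  case (cmul u c)
  then obtain u' where "u' \<in> kalg W p" "has_pd b u u' (off_path p)" by blast
  then show ?case by (intro bexI[of _ "\<lambda>x. c \<odot> u' x"] kalg.cmul has_pd_cmul)
next
  case (add u v)
  then obtain u' v' where "u' \<in> kalg W p" "has_pd b u u' (off_path p)"
      "v' \<in> kalg W p" "has_pd b v v' (off_path p)" by blast
  then show ?case by (intro bexI[of _ "\<lambda>x. u' x + v' x"] kalg.add has_pd_add)
qed

text \<open>The circle of integration, hence \<open>W\<close> and \<open>p\<close>, changes from
  point to point, so a global function is matched with kernels only on neighbourhoods.\<close>

definition locally_kernel :: "('m::{finite,linorder}) paravec set \<Rightarrow> ('m paravec \<Rightarrow> 'm clifford) set" where
  "locally_kernel U = {u. \<forall>x\<in>U. \<exists>V W p. \<exists>v\<in>kalg W p. open V \<and> x \<in> V \<and> V \<subseteq> off_path p \<and>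
     continuous_on {0..1} p \<and> (\<forall>A. continuous_on {0..1} (W A)) \<and> (\<forall>y\<in>V. u y = v y)}"

lemma locally_kernelE:
  assumes "u \<in> locally_kernel U" "x \<in> U"
  obtains v W p V where "v \<in> kalg W p" "open V" "x \<in> V" "V \<subseteq> off_path p"
     "continuous_on {0..1} p" "\<forall>A. continuous_on {0..1} (W A)" "\<forall>y\<in>V. u y = v y"
proof -
  from bspec[OF assms(1)[unfolded locally_kernel_def mem_Collect_eq] assms(2)] show ?thesis
    by (elim exE bexE conjE) (rule that)
qed

lemma locally_kernelI:
  assumes "\<And>x. x \<in> U \<Longrightarrow> \<exists>V W p v. v \<in> kalg W p \<and> open V \<and> x \<in> V \<and> V \<subseteq> off_path p \<and>
     continuous_on {0..1} p \<and> (\<forall>A. continuous_on {0..1} (W A)) \<and> (\<forall>y\<in>V. u y = v y)"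
  shows "u \<in> locally_kernel U"
  unfolding locally_kernel_def mem_Collect_eq
proof
  fix x assume "x \<in> U"
  from assms[OF this] show "\<exists>V W p. \<exists>v\<in>kalg W p. open V \<and> x \<in> V \<and> V \<subseteq> off_path p \<and>
     continuous_on {0..1} p \<and> (\<forall>A. continuous_on {0..1} (W A)) \<and> (\<forall>y\<in>V. u y = v y)"
    by (elim exE conjE) (intro exI bexI conjI)
qed

lemma has_pd_subset: "has_pd b u u' V \<Longrightarrow> U \<subseteq> V \<Longrightarrow> has_pd b u u' U"
  by (auto simp: has_pd_def)

lemma locally_kernel_continuous_on:
  assumes "u \<in> locally_kernel U" shows "continuous_on U u"
proof (rule continuous_at_imp_continuous_on, rule)
  fix x assume x: "x \<in> U"
  obtain V W p v where ex: "v \<in> kalg W p" "open V" "x \<in> V" "V \<subseteq> off_path p"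
     "continuous_on {0..1} p" "\<forall>A. continuous_on {0..1} (W A)" "\<forall>y\<in>V. u y = v y"
    by (rule locally_kernelE[OF assms x]) (rule that)
    note * = ex(1-5) ex(6)[rule_format] ex(7)[rule_format]
  have "continuous_on V u"
    using continuous_on_subset[OF continuous_on_kalg[OF *(1,5,6)] *(4)]
    by (rule continuous_on_eq) (use *(7) in simp)
  then show "isCont u x" using *(2,3) by (simp add: continuous_on_eq_continuous_at)
qed

text \<open>An equality on an open neighbourhood passes to derivatives, and \<open>kalg\<close> is
  closed under them. Iterating this gives every order of differentiability.\<close>

lemma locally_kernel_pd:
  assumes "u \<in> locally_kernel U"
  shows "pd b u \<in> locally_kernel U" and "has_pd b u (pd b u) U"
proof -
  have *: "(\<exists>V W p v. v \<in> kalg W p \<and> open V \<and> x \<in> V \<and> V \<subseteq> off_path p \<and> continuous_on {0..1} p \<and>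
     (\<forall>A. continuous_on {0..1} (W A)) \<and> (\<forall>y\<in>V. pd b u y = v y)) \<and>
     ((\<lambda>s. u (x + s *\<^sub>R b)) has_vector_derivative pd b u x) (at 0)" if x: "x \<in> U" for x
  proof -
    obtain V W p v where ex: "v \<in> kalg W p" "open V" "x \<in> V" "V \<subseteq> off_path p"
       "continuous_on {0..1} p" "\<forall>A. continuous_on {0..1} (W A)" "\<forall>y\<in>V. u y = v y"
      by (rule locally_kernelE[OF assms x]) (rule that)
    note * = ex(1-5) ex(6)[rule_format] ex(7)[rule_format]
    from kalg_has_pd[OF *(1,5,6)] obtain v' where v': "v' \<in> kalg W p" "has_pd b v v' (off_path p)" ..
    have d: "has_pd b u v' V"
      using has_pd_subset[OF v'(2) *(4)] has_pd_cong[OF *(2), of u v v' v'] *(7) by simp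
    then have "\<forall>y\<in>V. pd b u y = v' y" by (simp add: pd_eq)
    moreover have "((\<lambda>s. u (x + s *\<^sub>R b)) has_vector_derivative pd b u x) (at 0)"
      using d *(3) pd_eq[OF d *(3)] by (simp add: has_pd_def)
    ultimately show ?thesis using * v'(1)
      by (intro conjI exI[of _ V] exI[of _ W] exI[of _ p] exI[of _ v'] allI)
  qed
  show "pd b u \<in> locally_kernel U" by (rule locally_kernelI) (rule conjunct1[OF *])
  show "has_pd b u (pd b u) U" unfolding has_pd_def by (rule ballI) (rule conjunct2[OF *])
qed

section \<open>The Cauchy formula for slice regular functions\<close>

lemma imag_sphere_iff: "J \<in> imag_sphere \<longleftrightarrow> fst J = 0 \<and> norm (snd J) = 1"
  by (simp add: imag_sphere_def norm_eq_1 inner_vec_def power2_eq_square)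

lemma imag_sphere_uminus: "J \<in> imag_sphere \<Longrightarrow> - J \<in> imag_sphere"
  by (simp add: imag_sphere_iff)

lemma imag_sphere_nonempty: "(0, axis i 1) \<in> imag_sphere"
  by (simp add: imag_sphere_iff)

lemma cpoint_simps:
  assumes "J \<in> imag_sphere"
  shows "fst (cpoint J z) = Re z" and "snd (cpoint J z) = Im z *\<^sub>R snd J"
  using assms by (auto simp: cpoint_def imag_sphere_iff)

lemma cpoint_cnj: "cpoint J (cnj z) = cpoint (- J) z"
  by (simp add: cpoint_def)

lemma upper_cpoint: "J \<in> imag_sphere \<Longrightarrow> upper (cpoint J z) = Complex (Re z) \<bar>Im z\<bar>"
  by (simp add: upper_def cpoint_simps imag_sphere_iff)

lemma paravec_polar: "\<exists>J\<in>imag_sphere. x = cpoint J (upper x)"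
proof (cases "snd x = 0")
  case True
  \<comment> \<open>At a real point the unit is arbitrary.\<close>
  then show ?thesis using imag_sphere_nonempty
    by (intro bexI[of _ "(0, axis undefined 1)"]) (auto simp: cpoint_def upper_def prod_eq_iff)
next
  case False
  then show ?thesis
    by (intro bexI[of _ "(0, snd x /\<^sub>R norm (snd x))"])
       (auto simp: cpoint_def upper_def prod_eq_iff imag_sphere_iff)
qed

lemma pv_imag_sphere_twice: "J \<in> imag_sphere \<Longrightarrow> pv J \<odot> (pv J \<odot> c) = - c"
  using pv_imag_cmul_twice[of "snd J" c]
  by (simp add: imag_sphere_iff norm_eq_1 flip: surjective_pairing) (metis prod.collapse)

lemma pv_scaleR: "pv (a *\<^sub>R x) = a *\<^sub>R pv x"
  by (simp add: pv_def scaleR_add_right scaleR_sum_right)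

lemma pv_uminus: "pv (- x) = - pv x"
  using pv_scaleR[of "-1" x] by simp

lemma pv_snd_cpoint: "J \<in> imag_sphere \<Longrightarrow> pv (0, snd (cpoint J z)) = Im z *\<^sub>R pv J"
  by (cases J) (simp add: cpoint_simps imag_sphere_iff flip: pv_scaleR)

text \<open>With z = \<open>upper x\<close>, (\<zeta> - x_0)/Q is the mean of 1/(\<zeta> - z) and
  1/(\<zeta> - cnj z), and Im z / Q is their difference over 2i. Keeping the factor Im z on the left
  avoids a division at real points.\<close>

lemma kint_partial_fractions:
  fixes x :: "('m::finite) paravec"
  assumes "x \<in> off_path p"
    and a: "((\<lambda>t. w t / (p t - upper x)) has_integral a) {0..1}"
    and b: "((\<lambda>t. w t / (p t - cnj (upper x))) has_integral b) {0..1}"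
  shows "kint w p 1 1 x = Re (a + b) / 2" and "Im (upper x) * kint w p 0 1 x = Im (a - b) / 2"
proof -
  have nz: "p t - upper x \<noteq> 0" "p t - cnj (upper x) \<noteq> 0" if "t \<in> {0..1}" for t
    using assms(1) that by (auto simp: off_path_def qden_factor)
  have "((\<lambda>t. w t * (p t - of_real (fst x)) ^ 1 * inverse (qden (p t) x) ^ 1) has_integral (a + b) / 2) {0..1}"
  proof (rule has_integral_eq[OF _ has_integral_divide[OF has_integral_add[OF a b]]])
    fix t :: real assume t: "t \<in> {0..1}"
    have "2 * of_real (fst x) = upper x + cnj (upper x)" by (simp add: upper_def complex_eq_iff)
    then have x0: "of_real (fst x) = (upper x + cnj (upper x)) / 2" by (simp add: field_simps)
    show "(w t / (p t - upper x) + w t / (p t - cnj (upper x))) / 2 =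
        w t * (p t - of_real (fst x)) ^ 1 * inverse (qden (p t) x) ^ 1"
      unfolding x0 qden_factor using nz[OF t] by (simp add: field_simps)
  qed
  from arg_cong[OF integral_unique[OF this], of Re] show "kint w p 1 1 x = Re (a + b) / 2"
    by (simp add: kint_def)
  have "((\<lambda>t. of_real (Im (upper x)) * (w t * (p t - of_real (fst x)) ^ 0 * inverse (qden (p t) x) ^ 1))
     has_integral (a - b) / (2 * \<i>)) {0..1}"
  proof (rule has_integral_eq[OF _ has_integral_divide[OF has_integral_diff[OF a b]]])
    fix t :: real assume t: "t \<in> {0..1}"
    have im: "of_real (Im (upper x)) = (upper x - cnj (upper x)) / (2 * \<i>)"
    proof -
      have "2 * \<i> * of_real (Im (upper x)) = upper x - cnj (upper x)" by (simp add: complex_eq_iff)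
      then show ?thesis by (simp add: field_simps)
    qed
    show "(w t / (p t - upper x) - w t / (p t - cnj (upper x))) / (2 * \<i>) =
        of_real (Im (upper x)) * (w t * (p t - of_real (fst x)) ^ 0 * inverse (qden (p t) x) ^ 1)"
      unfolding im qden_factor using nz[OF t] by (simp add: field_simps)
  qed
  from integral_unique[OF this]
  have "of_real (Im (upper x)) * integral {0..1} (\<lambda>t. w t * (p t - of_real (fst x)) ^ 0 * inverse (qden (p t) x) ^ 1)
      = (a - b) / (2 * \<i>)"
    by simp
  from arg_cong[OF this, of Re] show "Im (upper x) * kint w p 0 1 x = Im (a - b) / 2"
    by (simp add: kint_def Re_divide field_simps)
qed

text \<open>The circle has velocity 2 pi i r exp(2 pi i t); dividing by the Cauchy constant leaves
  the weight r exp(2 pi i t).\<close>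

lemma Cauchy_circle_has_integral:
  assumes "((\<lambda>u. \<phi> u / (u - z)) has_contour_integral (2 * of_real pi * \<i> * c)) (circlepath z0 r)"
  shows "((\<lambda>t. \<phi> (circlepath z0 r t) * (of_real r * exp (2 * of_real pi * \<i> * of_real t)) / (circlepath z0 r t - z))
     has_integral c) {0..1}"
proof -
  have "((\<lambda>t. \<phi> (circlepath z0 r t) / (circlepath z0 r t - z) *
      vector_derivative (circlepath z0 r) (at t within {0..1}) / (2 * of_real pi * \<i>)) has_integral c) {0..1}"
    using has_integral_divide[OF assms[unfolded has_contour_integral_def], of "2 * of_real pi * \<i>"] by simp
  then show ?thesis
    by (rule has_integral_eq[rotated]) (simp add: vector_derivative_circlepath01)
qed

lemma vec_axis_expansion: "(\<Sum>A\<in>UNIV. (v $ A) *\<^sub>R axis A 1) = (v :: real ^ 'k::finite)"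
  by (simp add: vec_eq_iff axis_def if_distrib cong: if_cong)

text \<open>
  A small circle about a point of the open upper half-plane misses the conjugate point, so the
  Cauchy integral only sees half of the partial fraction decomposition of the kernel;
  this is compensated by a factor 2 in the weights.
\<close>

lemma slice_regular1_kernel:
  fixes u :: "('m::{finite,linorder}) paravec \<Rightarrow> 'm clifford"
  assumes "open E" "cnj ` E = E" "slice_regular1 E u" "z0 \<in> E" "0 \<le> Im z0"
  obtains r W p where "r > 0" "continuous_on {0..1} p" "\<forall>A. continuous_on {0..1} (W A)"
    "\<forall>x. upper x \<in> ball z0 r \<longrightarrow> x \<in> off_path p \<and> u x = kslice W p 1 x"
proof -
  obtain G0 G1 G0' G1' where rep: "represents1 E G0 G1 u"
    and d0: "\<And>z. z \<in> E \<Longrightarrow> (G0 has_derivative blinfun_apply (G0' z)) (at z)"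
    and d1: "\<And>z. z \<in> E \<Longrightarrow> (G1 has_derivative blinfun_apply (G1' z)) (at z)"
    and CR: "\<And>z. z \<in> E \<Longrightarrow> blinfun_apply (G0' z) 1 = blinfun_apply (G1' z) \<i>"
      "\<And>z. z \<in> E \<Longrightarrow> blinfun_apply (G0' z) \<i> = - blinfun_apply (G1' z) 1"
    using assms(3) unfolding slice_regular1_def by blast
  \<comment> \<open>The equations for \<open>G0\<close> and \<open>G1\<close> are the Cauchy-Riemann
    equations, coordinate by coordinate, so \<open>G0 + i G1\<close> is holomorphic in each
    coordinate.\<close>
  define \<phi> where "\<phi> = (\<lambda>A z. Complex (G0 z $ A) (G1 z $ A))"
  have hol: "\<phi> A holomorphic_on E" for A
  proof -
    have "(\<phi> A has_field_derivative Complex (G0' z 1 $ A) (G1' z 1 $ A)) (at z)" if z: "z \<in> E" for z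
    proof -
      have lin: "blinfun_apply B h = Re h *\<^sub>R B 1 + Im h *\<^sub>R B \<i>" for B :: "complex \<Rightarrow>\<^sub>L 'm clifford" and h
      proof -
        have "h = Re h *\<^sub>R 1 + Im h *\<^sub>R \<i>" by (simp add: complex_eq_iff)
        then show ?thesis by (metis blinfun.add_right blinfun.scaleR_right)
      qed
      have "(\<phi> A has_derivative (\<lambda>h. of_real (G0' z h $ A) + \<i> * of_real (G1' z h $ A))) (at z)"
        unfolding \<phi>_def Complex_eq
        by (intro has_derivative_add has_derivative_mult_right has_derivative_of_real
            bounded_linear.has_derivative[OF bounded_linear_vec_nth] d0 d1 z)
      moreover have "(\<lambda>h. of_real (G0' z h $ A) + \<i> * of_real (G1' z h $ A)) = (*) (Complex (G0' z 1 $ A) (G1' z 1 $ A))"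
      proof
        fix h
        show "of_real (G0' z h $ A) + \<i> * of_real (G1' z h $ A) = Complex (G0' z 1 $ A) (G1' z 1 $ A) * h"
          unfolding lin[of "G0' z" h] lin[of "G1' z" h] CR[OF z] by (simp add: complex_eq_iff algebra_simps)
      qed
      ultimately show ?thesis by (simp add: has_field_derivative_def)
    qed
    then show ?thesis
      using holomorphic_on_open[OF assms(1)] by blast
  qed
  obtain R0 where R0: "R0 > 0" "ball z0 R0 \<subseteq> E"
    using assms(1,4) open_contains_ball by blast
  \<comment> \<open>For a centre off the real axis the bound by \<open>Im z0\<close> keeps the ball
    in the open upper half-plane. About a real centre the ball is symmetric, and both roots of Q lie
    inside the circle.\<close>
  define R where "R = (if Im z0 = 0 then R0 else min R0 (Im z0))"
  define r where "r = R / 2"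
  have R: "R > 0" "ball z0 R \<subseteq> E" and r: "r > 0" "cball z0 r \<subseteq> ball z0 R" "cball z0 r \<subseteq> E"
    using R0 assms(5) by (auto simp: R_def r_def split: if_splits)
  define \<kappa> :: complex where "\<kappa> = (if Im z0 = 0 then 1 else 2)"
  define p where "p = circlepath z0 r"
  define W where "W = (\<lambda>A t. \<kappa> * (\<phi> A (p t) * (of_real r * exp (2 * of_real pi * \<i> * of_real t))))"
  have p: "continuous_on {0..1} p" unfolding p_def using path_circlepath by (simp add: path_def)
  have pE: "p t \<in> sphere z0 r" if "t \<in> {0..1}" for t
    using path_image_circlepath_nonneg[of r z0] r(1) that unfolding p_def path_image_def by auto
  have W: "continuous_on {0..1} (W A)" for A
    unfolding W_def using pE r(3)
    by (intro continuous_intros continuous_on_compose2[OF holomorphic_on_imp_continuous_on[OF hol] p]) auto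
  have "x \<in> off_path p \<and> u x = kslice W p 1 x" if x: "upper x \<in> ball z0 r" for x
  proof -
    have z: "upper x \<in> E" using x r(3) by auto
    have inside: "((\<lambda>t. W A t / (p t - z)) has_integral \<kappa> * \<phi> A z) {0..1}" if "z \<in> ball z0 r" for A z
    proof -
      have "\<phi> A holomorphic_on cball z0 r" using hol r(3) by (rule holomorphic_on_subset)
      moreover have "norm (z - z0) < r" using that by (simp add: dist_norm norm_minus_commute)
      ultimately have "((\<lambda>u. \<phi> A u / (u - z)) has_contour_integral 2 * of_real pi * \<i> * \<phi> A z) (circlepath z0 r)"
        by (rule Cauchy_integral_circlepath_simple)
      from has_integral_mult_right[OF Cauchy_circle_has_integral[OF this], of \<kappa>] show ?thesis
        by (simp add: W_def p_def)
    qed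
    have outside: "((\<lambda>t. W A t / (p t - z)) has_integral 0) {0..1}" if "z \<notin> ball z0 R" for A z
    proof -
      have "(\<lambda>u. \<phi> A u / (u - z)) holomorphic_on ball z0 R"
        using that by (intro holomorphic_intros holomorphic_on_subset[OF hol R(2)]) auto
      then have "((\<lambda>u. \<phi> A u / (u - z)) has_contour_integral 0) (circlepath z0 r)"
        using r(1,2) by (intro Cauchy_theorem_disc_simple[of _ z0 R]) auto
      then have "((\<lambda>u. \<phi> A u / (u - z)) has_contour_integral 2 * of_real pi * \<i> * 0) (circlepath z0 r)"
        by simp
      from has_integral_mult_right[OF Cauchy_circle_has_integral[OF this], of \<kappa>] show ?thesis
        by (simp add: W_def p_def)
    qed
    have cnj_far: "cnj (upper x) \<notin> ball z0 R" if "Im z0 \<noteq> 0"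
    proof -
      have "Im z0 \<le> \<bar>Im (z0 - cnj (upper x))\<bar>"
        using assms(5) norm_ge_zero[of "snd x"] by (simp add: upper_def)
      also have "\<dots> \<le> dist z0 (cnj (upper x))" unfolding dist_norm by (rule abs_Im_le_cmod)
      finally show ?thesis using that by (simp add: R_def)
    qed
    have cnj_near: "cnj (upper x) \<in> ball z0 r" if "Im z0 = 0"
    proof -
      have "cnj z0 = z0" using that by (simp add: complex_eq_iff)
      then have "dist z0 (cnj (upper x)) = dist (cnj z0) (cnj (upper x))" by simp
      also have "\<dots> = dist z0 (upper x)" by (simp add: dist_norm flip: complex_cnj_diff)
      finally show ?thesis using x by simp
    qed
    have off: "x \<in> off_path p"
    proof -
      have "p t \<noteq> upper x" "p t \<noteq> cnj (upper x)" if "t \<in> {0..1}" for t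
      proof -
        show "p t \<noteq> upper x" using pE[OF that] x by auto
        have "p t \<in> ball z0 R" using pE[OF that] r(2) by auto
        then show "p t \<noteq> cnj (upper x)"
          using pE[OF that] cnj_far cnj_near by (cases "Im z0 = 0") auto
      qed
      then show ?thesis by (simp add: off_path_def qden_factor)
    qed
    \<comment> \<open>The parity of \<open>G0\<close> and \<open>G1\<close> is a reflection
      principle. In the real-centred case it makes the residues at the two roots conjugate, so the
      half sum and half difference give \<open>G0\<close> and \<open>G1\<close>.\<close>
    have conj: "\<phi> A (cnj (upper x)) = cnj (\<phi> A (upper x))" for A
      using rep z by (auto simp: represents1_def \<phi>_def complex_eq_iff)
    have k: "kint (W A) p 1 1 x = G0 (upper x) $ A \<and> Im (upper x) * kint (W A) p 0 1 x = G1 (upper x) $ A" for A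
    proof (cases "Im z0 = 0")
      case True
      with kint_partial_fractions[OF off inside[OF x, of A] inside[OF cnj_near[OF True], of A]]
      show ?thesis by (simp add: \<kappa>_def conj) (simp add: \<phi>_def)
    next
      case False
      with kint_partial_fractions[OF off inside[OF x, of A] outside[OF cnj_far[OF False], of A]]
      show ?thesis by (simp add: \<kappa>_def) (simp add: \<phi>_def)
    qed
    obtain J where J: "J \<in> imag_sphere" "x = cpoint J (upper x)" using paravec_polar by blast
    have "pv (0, snd x) \<odot> kvec W p 0 1 x = pv J \<odot> (Im (upper x) *\<^sub>R kvec W p 0 1 x)"
      using pv_snd_cpoint[OF J(1), of "upper x"] J(2) by (simp add: cmul.scaleR_left cmul.scaleR_right)
    also have "Im (upper x) *\<^sub>R kvec W p 0 1 x = G1 (upper x)"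
      using k by (simp add: kvec_def scaleR_sum_right vec_axis_expansion)
    finally have "kslice W p 1 x = G0 (upper x) + pv J \<odot> G1 (upper x)"
      using k by (simp add: kslice_def kvec_def vec_axis_expansion)
    also have "\<dots> = u x"
      using rep z J unfolding represents1_def by metis
    finally show ?thesis using off by simp
  qed
  with that[OF r(1) p] W show ?thesis by blast
qed

lemma kslice_in_locally_kernel:
  assumes "continuous_on {0..1} p" "\<And>A. continuous_on {0..1} (W A)"
  shows "kslice W p k \<in> locally_kernel (off_path p)"
  unfolding locally_kernel_def using assms kslice_in_kalg[of W p k] open_off_path[OF assms(1)] by blast

lemma lap1_scaleR:
  assumes "u \<in> locally_kernel U" "open U" "x \<in> U"
  shows "lap1 (\<lambda>x. c *\<^sub>R u x) x = c *\<^sub>R lap1 u x"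
proof -
  have "has_pd b (\<lambda>x. c *\<^sub>R u x) (\<lambda>x. c *\<^sub>R pd b u x) U"
    "has_pd b (\<lambda>x. c *\<^sub>R pd b u x) (\<lambda>x. c *\<^sub>R pd b (pd b u) x) U" for b
    by (intro has_pd_scaleR locally_kernel_pd(2) locally_kernel_pd(1) assms(1))+
  then show ?thesis
    unfolding lap1_def scaleR_sum_right by (intro sum.cong refl pd_pd[OF assms(2) _ _ assms(3)])
qed

text \<open>The accumulated factors of \<open>lap1_kslice\<close>. For odd m the first zero factor
  has i = (m - 1)/2, so the constant is nonzero up to k = (m - 1)/2 and zero afterwards.\<close>

definition sce_coeff :: "nat \<Rightarrow> nat \<Rightarrow> real" where
  "sce_coeff m k = (\<Prod>i<k. 2 * real (Suc i) * (2 * real (Suc i) - 1 - real m))"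

lemma lap1_power_kernel:
  fixes u :: "('m::{finite,linorder}) paravec \<Rightarrow> 'm clifford"
  assumes "continuous_on {0..1} p" "\<And>A. continuous_on {0..1} (W A)"
    and "open U" "U \<subseteq> off_path p" "\<And>x. x \<in> U \<Longrightarrow> u x = kslice W p 1 x" "x \<in> U"
  shows "(lap1 ^^ k) u x = sce_coeff CARD('m) k *\<^sub>R kslice W p (Suc k) x"
  using assms(6)
proof (induction k arbitrary: x)
  case 0
  then show ?case by (simp add: assms(5) sce_coeff_def)
next
  case (Suc k)
  have "(lap1 ^^ Suc k) u x = lap1 (\<lambda>x. sce_coeff CARD('m) k *\<^sub>R kslice W p (Suc k) x) x"
    unfolding funpow.simps o_def by (rule lap1_cong[OF assms(3) Suc.IH Suc.prems])
  also have "\<dots> = sce_coeff CARD('m) k *\<^sub>R lap1 (kslice W p (Suc k)) x"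
    using Suc.prems assms(4)
    by (intro lap1_scaleR[OF kslice_in_locally_kernel open_off_path] assms(1,2)) auto
  also have "\<dots> = sce_coeff CARD('m) (Suc k) *\<^sub>R kslice W p (Suc (Suc k)) x"
    using Suc.prems assms(4) by (subst lap1_kslice[OF assms(1,2)]) (auto simp: sce_coeff_def)
  finally show ?case .
qed

section \<open>The Fueter-Sce theorem in one variable\<close>

lemma upper_cpoint_in_iff:
  assumes "cnj ` E = E" "J \<in> imag_sphere"
  shows "upper (cpoint J z) \<in> E \<longleftrightarrow> z \<in> E"
proof -
  have "upper (cpoint J z) = z \<or> upper (cpoint J z) = cnj z"
    using upper_cpoint[OF assms(2), of z] by (auto simp: complex_eq_iff abs_if)
  moreover have "cnj z \<in> E \<longleftrightarrow> z \<in> E"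
    using assms(1) by (metis complex_cnj_cnj imageI)
  ultimately show ?thesis by auto
qed

lemma circ1_eq:
  assumes "cnj ` E = E"
  shows "(circ1 E :: ('m::finite) paravec set) = {x. upper x \<in> E}"
proof (intro set_eqI iffI)
  fix x :: "'m paravec"
  assume "x \<in> circ1 E"
  then show "x \<in> {x. upper x \<in> E}"
    using upper_cpoint_in_iff[OF assms] by (auto simp: circ1_def)
next
  fix x :: "'m paravec"
  assume "x \<in> {x. upper x \<in> E}"
  then show "x \<in> circ1 E"
    using paravec_polar[of x] by (auto simp: circ1_def)
qed

lemma open_upper_vimage: "open E \<Longrightarrow> open {x. upper x \<in> E}"
  using open_vimage[of E upper] by (simp add: vimage_def continuous_on_upper[OF continuous_on_id])

text \<open>The source of the slice property: the kernel sees v only through |v|^2, so its integrals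
  do not depend on the imaginary unit.\<close>

lemma kvec_cong:
  assumes "fst x = fst y" "snd x \<bullet> snd x = snd y \<bullet> snd y"
  shows "kvec W p j k x = kvec W p j k y"
  using assms by (simp add: kvec_def kint_def qden_def)

lemma kvec_cpoint:
  assumes "J \<in> imag_sphere" "I \<in> imag_sphere"
  shows "kvec W p j k (cpoint J z) = kvec W p j k (cpoint I z)"
    and "kvec W p j k (cpoint J (cnj z)) = kvec W p j k (cpoint J z)"
  by (rule kvec_cong; use assms in \<open>simp add: cpoint_simps imag_sphere_iff norm_eq_1\<close>)+

lemma kslice_cpoint:
  assumes "J \<in> imag_sphere"
  shows "kslice W p k (cpoint J z) =
    kvec W p 1 k (cpoint J z) + pv J \<odot> (Im z *\<^sub>R kvec W p 0 k (cpoint J z))"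
  by (simp add: kslice_def pv_snd_cpoint[OF assms] cmul.scaleR_left cmul.scaleR_right)

text \<open>Parity comes out of the construction: a and b are recovered from the values at I and -I,
  and conjugating z exchanges these two values.\<close>

lemma slice1I:
  assumes "cnj ` E = E"
    and "\<And>z. z \<in> E \<Longrightarrow> \<exists>a b. \<forall>J\<in>imag_sphere. u (cpoint J z) = a + pv J \<odot> b"
  shows "slice1 E u"
proof -
  define I :: "'a paravec" where "I = (0, axis undefined 1)"
  have I: "I \<in> imag_sphere" "- I \<in> imag_sphere"
    unfolding I_def using imag_sphere_nonempty imag_sphere_uminus by blast+
  define G0 where "G0 = (\<lambda>z. (1/2) *\<^sub>R (u (cpoint I z) + u (cpoint (- I) z)))"
  define G1 where "G1 = (\<lambda>z. (-1/2) *\<^sub>R (pv I \<odot> (u (cpoint I z) - u (cpoint (- I) z))))"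
  have "G0 (cnj z) = G0 z \<and> G1 (cnj z) = - G1 z" for z
    by (simp add: G0_def G1_def cpoint_cnj cmul.diff_right algebra_simps)
  moreover have "u (cpoint J z) = G0 z + pv J \<odot> G1 z" if z: "z \<in> E" and J: "J \<in> imag_sphere" for z J
  proof -
    obtain a b where ab: "\<And>J. J \<in> imag_sphere \<Longrightarrow> u (cpoint J z) = a + pv J \<odot> b"
      using assms(2)[OF z] by blast
    have "G0 z = a" "G1 z = b"
      unfolding G0_def G1_def ab[OF I(1)] ab[OF I(2)]
      by (simp_all add: pv_uminus cmul.minus_left cmul.add_right cmul.scaleR_right pv_imag_sphere_twice[OF I(1)]
          flip: scaleR_2)
    then show ?thesis using ab[OF J] by simp
  qed
  ultimately show ?thesis unfolding slice1_def represents1_def by blast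
qed

context
  fixes E :: "complex set" and u :: "('m::{finite,linorder}) paravec \<Rightarrow> 'm clifford"
  assumes E: "open E" "cnj ` E = E" and u: "slice_regular1 E u"
begin

text \<open>One circle serves all powers k. The neighbourhood is a preimage under
  \<open>upper\<close>, so with each point it contains the whole sphere of points with other units;
  comparisons between units and with the conjugate point stay inside it.\<close>

lemma lap1_power_local:
  assumes "upper x \<in> E"
  obtains r W p where "r > 0" "continuous_on {0..1} p" "\<forall>A. continuous_on {0..1} (W A)"
    "{y. upper y \<in> ball (upper x) r} \<subseteq> (off_path p :: 'm paravec set)"
    "\<forall>y k. upper y \<in> ball (upper x) r \<longrightarrow>
       (lap1 ^^ k) u y = sce_coeff CARD('m) k *\<^sub>R kslice W p (Suc k) y"
proof -
  have "0 \<le> Im (upper x)" by (simp add: upper_def)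
  then obtain r W p where ex: "r > 0" "continuous_on {0..1} p" "\<forall>A. continuous_on {0..1} (W A)"
    "\<forall>y. upper y \<in> ball (upper x) r \<longrightarrow> y \<in> off_path p \<and> u y = kslice W p 1 y"
    by (rule slice_regular1_kernel[OF E u assms]) (rule that)
  note rWp = ex(1,2) ex(3)[rule_format] ex(4)[rule_format]
  show ?thesis
  proof (rule that[OF rWp(1,2)])
    show "\<forall>A. continuous_on {0..1} (W A)" using rWp(3) by blast
    show "{y. upper y \<in> ball (upper x) r} \<subseteq> (off_path p :: 'm paravec set)"
      using rWp(4) by blast
    have "(lap1 ^^ k) u y = sce_coeff CARD('m) k *\<^sub>R kslice W p (Suc k) y"
      if "upper y \<in> ball (upper x) r" for y k
      by (rule lap1_power_kernel[OF rWp(2,3) open_upper_vimage[of "ball (upper x) r"]])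
         (use rWp(4) that in auto)
    then show "\<forall>y k. upper y \<in> ball (upper x) r \<longrightarrow>
       (lap1 ^^ k) u y = sce_coeff CARD('m) k *\<^sub>R kslice W p (Suc k) y" by blast
  qed
qed

lemma lap1_power_locally_kernel: "(lap1 ^^ k) u \<in> locally_kernel {x. upper x \<in> E}"
proof (rule locally_kernelI)
  fix x :: "'m paravec" assume "x \<in> {x. upper x \<in> E}"
  then have "upper x \<in> E" by simp
  then obtain r W p where ex: "r > 0" "continuous_on {0..1} p" "\<forall>A. continuous_on {0..1} (W A)"
    "{y. upper y \<in> ball (upper x) r} \<subseteq> (off_path p :: 'm paravec set)"
    "\<forall>y k. upper y \<in> ball (upper x) r \<longrightarrow>
       (lap1 ^^ k) u y = sce_coeff CARD('m) k *\<^sub>R kslice W p (Suc k) y"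
    by (rule lap1_power_local) (rule that)
  note * = ex(1,2) ex(3)[rule_format] ex(4) ex(5)[rule_format]
  show "\<exists>V W p v. v \<in> kalg W p \<and> open V \<and> x \<in> V \<and> V \<subseteq> off_path p \<and>
     continuous_on {0..1} p \<and> (\<forall>A. continuous_on {0..1} (W A)) \<and> (\<forall>y\<in>V. (lap1 ^^ k) u y = v y)"
    by (rule exI[of _ "{y. upper y \<in> ball (upper x) r}"], rule exI[of _ W], rule exI[of _ p],
        rule exI[of _ "\<lambda>x. sce_coeff CARD('m) k *\<^sub>R kslice W p (Suc k) x"])
       (use * in \<open>simp add: kalg_scaleR kslice_in_kalg open_upper_vimage[of "ball (upper x) r", simplified]\<close>)
qed

lemma slice1_lap1_power: "slice1 E ((lap1 ^^ k) u)"
proof (rule slice1I[OF E(2)])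
  fix z assume z: "z \<in> E"
  define I :: "'m paravec" where "I = (0, axis undefined 1)"
  have I: "I \<in> imag_sphere" unfolding I_def by (rule imag_sphere_nonempty)
  then have zI: "upper (cpoint I z) \<in> E" using z upper_cpoint_in_iff[OF E(2)] by blast
  obtain r W p where ex: "r > 0"
    "\<forall>y k. upper y \<in> ball (upper (cpoint I z)) r \<longrightarrow>
       (lap1 ^^ k) u y = sce_coeff CARD('m) k *\<^sub>R kslice W p (Suc k) y"
    by (rule lap1_power_local[OF zI]) (rule that)
  note * = ex(1) ex(2)[rule_format]
  have "(lap1 ^^ k) u (cpoint J z) = sce_coeff CARD('m) k *\<^sub>R kvec W p 1 (Suc k) (cpoint I z)
      + pv J \<odot> (sce_coeff CARD('m) k *\<^sub>R Im z *\<^sub>R kvec W p 0 (Suc k) (cpoint I z))"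
    if J: "J \<in> imag_sphere" for J
    using *(2)[of "cpoint J z" k] *(1)
    by (simp add: upper_cpoint I J kslice_cpoint kvec_cpoint(1)[OF J I] cmul.scaleR_right scaleR_add_right)
  then show "\<exists>a b. \<forall>J\<in>imag_sphere. (lap1 ^^ k) u (cpoint J z) = a + pv J \<odot> b" by blast
qed

lemma dbar1_lap1_power:
  assumes "CARD('m) = 2 * k + 1" "upper x \<in> E"
  shows "dbar1 ((lap1 ^^ k) u) x = 0"
proof -
  obtain r W p where ex: "r > 0" "continuous_on {0..1} p" "\<forall>A. continuous_on {0..1} (W A)"
    "{y. upper y \<in> ball (upper x) r} \<subseteq> (off_path p :: 'm paravec set)"
    "\<forall>y k. upper y \<in> ball (upper x) r \<longrightarrow>
       (lap1 ^^ k) u y = sce_coeff CARD('m) k *\<^sub>R kslice W p (Suc k) y"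
    by (rule lap1_power_local[OF assms(2)]) (rule that)
  note * = ex(1,2) ex(3)[rule_format] ex(4) ex(5)[rule_format]
  have x: "x \<in> off_path p" using *(1,4) by auto
  have "pd b ((lap1 ^^ k) u) x = sce_coeff CARD('m) k *\<^sub>R pd b (kslice W p (Suc k)) x" for b
  proof -
    have "pd b ((lap1 ^^ k) u) x = pd b (\<lambda>y. sce_coeff CARD('m) k *\<^sub>R kslice W p (Suc k) y) x"
      by (rule pd_cong[OF open_upper_vimage[of "ball (upper x) r"]]) (use *(1,5) in auto)
    also have "\<dots> = sce_coeff CARD('m) k *\<^sub>R pd b (kslice W p (Suc k)) x"
      by (rule pd_eq[OF has_pd_scaleR[OF has_pd_pd[OF open_off_path[OF *(2)] has_pd_kslice[OF *(2,3)]]] x])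
    finally show ?thesis .
  qed
  then have "dbar1 ((lap1 ^^ k) u) x = sce_coeff CARD('m) k *\<^sub>R dbar1 (kslice W p (Suc k)) x"
    by (simp add: dbar1_def cmul.scaleR_right scaleR_add_right scaleR_sum_right)
  also have "dbar1 (kslice W p (Suc k)) x = 0"
    by (rule dbar1_kslice[OF *(2,3) x]) (simp add: assms(1))
  finally show ?thesis by simp
qed

text \<open>
  On the plane of \<open>J\<close>, off the real axis, a Laplacian amounts to a first order operator with real
  coefficients which does not depend on \<open>J\<close>.
\<close>

lemma lap1_power_recursion:
  assumes J: "J \<in> imag_sphere" and z: "z \<in> E" "Im z \<noteq> 0"
  shows "((\<lambda>t. (lap1 ^^ k) u (cpoint J (z + of_real t * \<i>))) has_vector_derivative
      pd J ((lap1 ^^ k) u) (cpoint J z)) (at 0)"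
    and "(lap1 ^^ Suc k) u (cpoint J z) = (real CARD('m) - 1 - 2 * real k) *\<^sub>R
      (inverse (Im z) *\<^sub>R pd J ((lap1 ^^ k) u) (cpoint J z)
       - inverse (2 * (Im z)\<^sup>2) *\<^sub>R ((lap1 ^^ k) u (cpoint J z) - (lap1 ^^ k) u (cpoint J (cnj z))))"
proof -
  have J': "J = (0, snd J)" using J by (simp add: imag_sphere_iff prod_eq_iff)
  have "cpoint J (z + of_real t * \<i>) = cpoint J z + t *\<^sub>R J" for t
    by (simp add: cpoint_def algebra_simps)
  moreover have "upper (cpoint J z) \<in> E" using upper_cpoint_in_iff[OF E(2) J] z by simp
  moreover from this have "((\<lambda>t. (lap1 ^^ k) u (cpoint J z + t *\<^sub>R J)) has_vector_derivative
      pd J ((lap1 ^^ k) u) (cpoint J z)) (at 0)"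
    by (intro bspec[OF locally_kernel_pd(2)[OF lap1_power_locally_kernel, unfolded has_pd_def]]) simp
  ultimately show "((\<lambda>t. (lap1 ^^ k) u (cpoint J (z + of_real t * \<i>))) has_vector_derivative
      pd J ((lap1 ^^ k) u) (cpoint J z)) (at 0)"
    by simp
  let ?x = "cpoint J z" and ?c = "sce_coeff CARD('m)" and ?K = "Suc k"
  obtain r W p where ex: "r > 0" "continuous_on {0..1} p" "\<forall>A. continuous_on {0..1} (W A)"
    "{y. upper y \<in> ball (upper ?x) r} \<subseteq> (off_path p :: 'm paravec set)"
    "\<forall>y k. upper y \<in> ball (upper ?x) r \<longrightarrow> (lap1 ^^ k) u y = ?c k *\<^sub>R kslice W p (Suc k) y"
    by (rule lap1_power_local[OF \<open>upper ?x \<in> E\<close>]) (rule that)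
  note * = ex(1,2) ex(3)[rule_format] ex(4) ex(5)[rule_format]
  have x: "?x \<in> off_path p" using *(1,4) by auto
  define P where "P = (\<lambda>j l. kvec W p j l ?x)"
  have snd: "snd ?x \<bullet> snd J = Im z"
    using J by (simp add: cpoint_simps imag_sphere_iff norm_eq_1)
  have pdk: "pd J (kvec W p j l) ?x = (- 2 * real l * Im z) *\<^sub>R P j (Suc l)" for j l
    using pd_eq[OF has_pd_kvec_imag[OF *(2,3), where y = "snd J" and j = j and k = l] x] snd J' by (simp add: P_def)
  have "pd J ((lap1 ^^ k) u) ?x = pd J (\<lambda>y. ?c k *\<^sub>R kslice W p ?K y) ?x"
    by (rule pd_cong[OF open_upper_vimage[of "ball (upper ?x) r"]]) (use *(1,5) in auto)
  also have "\<dots> = ?c k *\<^sub>R ((- 2 * real ?K * Im z) *\<^sub>R P 1 (Suc ?K)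
      + (- 2 * real ?K * Im z * Im z) *\<^sub>R (pv J \<odot> P 0 (Suc ?K)) + pv J \<odot> P 0 ?K)"
    unfolding pd_eq[OF has_pd_scaleR[OF has_pd_kslice[OF *(2,3)]] x] pdk pv_snd_cpoint[OF J]
    using J' by (simp add: cmul.scaleR_left cmul.scaleR_right P_def)
  finally have d: "pd J ((lap1 ^^ k) u) ?x = \<dots>" .
  have ball: "upper ?x \<in> ball (upper ?x) r" "upper (cpoint J (cnj z)) \<in> ball (upper ?x) r"
    using *(1) by (simp_all add: upper_cpoint J)
  \<comment> \<open>Conjugation fixes the even part, so the difference isolates the odd one. Its
    role is to cancel the last term of \<open>d\<close>, which arises from differentiating the
    factor v.\<close>
  have o: "(lap1 ^^ k) u ?x - (lap1 ^^ k) u (cpoint J (cnj z)) = (2 * ?c k * Im z) *\<^sub>R (pv J \<odot> P 0 ?K)"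
    unfolding *(5)[OF ball(1)] *(5)[OF ball(2)] kslice_cpoint[OF J] kvec_cpoint(2)[OF J J]
    by (simp add: P_def cmul.scaleR_right cmul.minus_right vec_eq_iff algebra_simps)
  have "(lap1 ^^ Suc k) u ?x = ?c (Suc k) *\<^sub>R (P 1 (Suc ?K) + Im z *\<^sub>R (pv J \<odot> P 0 (Suc ?K)))"
    unfolding *(5)[OF ball(1)] kslice_cpoint[OF J] by (simp add: P_def cmul.scaleR_right)
  also have "?c (Suc k) = ?c k * (2 * real ?K * (2 * real ?K - 1 - CARD('m)))"
    by (simp add: sce_coeff_def)
  finally show "(lap1 ^^ Suc k) u ?x = (real CARD('m) - 1 - 2 * real k) *\<^sub>R
      (inverse (Im z) *\<^sub>R pd J ((lap1 ^^ k) u) ?x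
       - inverse (2 * (Im z)\<^sup>2) *\<^sub>R ((lap1 ^^ k) u ?x - (lap1 ^^ k) u (cpoint J (cnj z))))"
    unfolding d o using z(2) by (simp add: vec_eq_iff field_simps power2_eq_square)
qed

end

lemma continuous_on_cpoint: "continuous_on S (cpoint J)"
  unfolding cpoint_def by (intro continuous_intros)

text \<open>Off the real axis, differentiating the relation in Im z and combining it with the
  relations at z and \<open>cnj z\<close> gives the next one, because the recursion has real
  coefficients common to all p. Real z are reached by continuity.\<close>

lemma slice_relation_lap1_power:
  fixes u :: "'p \<Rightarrow> ('m::{finite,linorder}) paravec \<Rightarrow> 'm clifford"
  assumes E: "open E" "cnj ` E = E"
    and u: "\<And>p. p \<in> P \<Longrightarrow> slice_regular1 E (u p)" and J: "\<And>p. p \<in> P \<Longrightarrow> J p \<in> imag_sphere"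
    and rel: "\<And>z. z \<in> E \<Longrightarrow> (\<Sum>p\<in>P. c p \<odot> u p (cpoint (J p) z)) = 0"
    and z: "z \<in> E"
  shows "(\<Sum>p\<in>P. c p \<odot> (lap1 ^^ k) (u p) (cpoint (J p) z)) = 0"
  using z
proof (induction k arbitrary: z)
  case 0
  then show ?case by (simp add: rel)
next
  case (Suc k)
  define S where "S = (\<lambda>k z. \<Sum>p\<in>P. c p \<odot> (lap1 ^^ k) (u p) (cpoint (J p) z))"
  have S0: "S k z = 0" if "z \<in> E" for z using Suc.IH[OF that] by (simp add: S_def)
  have near: "eventually (\<lambda>t. z + of_real t * \<i> \<in> E) (nhds 0)" if "z \<in> E" for z
    using eventually_line[OF E(1) that, of \<i>] by (simp add: scaleR_conv_of_real)
  have nonreal: "S (Suc k) z = 0" if z: "z \<in> E" "Im z \<noteq> 0" for z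
  proof -
    define d where "d = (\<lambda>p. pd (J p) ((lap1 ^^ k) (u p)) (cpoint (J p) z))"
    have "((\<lambda>t. S k (z + of_real t * \<i>)) has_vector_derivative (\<Sum>p\<in>P. c p \<odot> d p)) (at 0)"
      unfolding S_def d_def
      by (intro has_vector_derivative_sum bounded_linear.has_vector_derivative[OF cmul.bounded_linear_right]
          lap1_power_recursion(1)[OF E u J z])
    moreover have "((\<lambda>t. S k (z + of_real t * \<i>)) has_vector_derivative 0) (at 0)
        \<longleftrightarrow> ((\<lambda>t::real. 0 :: 'm clifford) has_vector_derivative 0) (at 0)"
      by (intro has_vector_derivative_cong_ev eventually_mono[OF near[OF z(1)]]) (auto simp: S0 z(1))
    \<comment> \<open>\<open>S k\<close> vanishes near z by the induction hypothesis, so its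
      vertical derivative is 0.\<close>
    ultimately have d0: "(\<Sum>p\<in>P. c p \<odot> d p) = 0"
      using vector_derivative_unique_at by auto
    have "S (Suc k) z = (\<Sum>p\<in>P. (real CARD('m) - 1 - 2 * real k) *\<^sub>R
      (inverse (Im z) *\<^sub>R (c p \<odot> d p) - inverse (2 * (Im z)\<^sup>2) *\<^sub>R
        (c p \<odot> (lap1 ^^ k) (u p) (cpoint (J p) z) - c p \<odot> (lap1 ^^ k) (u p) (cpoint (J p) (cnj z)))))"
      unfolding S_def d_def
      by (intro sum.cong refl, subst lap1_power_recursion(2)[OF E u J z])
         (auto simp: cmul.scaleR_right cmul.diff_right)
    also have "\<dots> = (real CARD('m) - 1 - 2 * real k) *\<^sub>R (inverse (Im z) *\<^sub>R (\<Sum>p\<in>P. c p \<odot> d p)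
        - inverse (2 * (Im z)\<^sup>2) *\<^sub>R (S k z - S k (cnj z)))"
      unfolding S_def by (simp only: scaleR_sum_right sum_subtractf scaleR_diff_right)
    also have "\<dots> = 0" using d0 S0[OF z(1)] S0[of "cnj z"] z(1) E(2) by auto
    finally show ?thesis .
  qed
  have cont: "continuous_on E (S (Suc k))"
    unfolding S_def
  proof (intro continuous_on_sum bounded_linear.continuous_on[OF cmul.bounded_linear_right])
    fix p assume p: "p \<in> P"
    show "continuous_on E (\<lambda>z. (lap1 ^^ Suc k) (u p) (cpoint (J p) z))"
      by (rule continuous_on_compose2[OF locally_kernel_continuous_on[OF
            lap1_power_locally_kernel[OF E u[OF p]]] continuous_on_cpoint])
         (auto simp: upper_cpoint_in_iff[OF E(2) J[OF p]])
  qed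
  have "S (Suc k) z = 0"
  proof (cases "Im z = 0")
    case True
    \<comment> \<open>The recursion divides by Im z; a real z is approached along the vertical line,
      whose other points in \<open>E\<close> are nonreal.\<close>
    have "isCont (S (Suc k)) z"
      using cont Suc.prems E(1) by (simp add: continuous_on_eq_continuous_at)
    then have "isCont (\<lambda>t. S (Suc k) (z + of_real t * \<i>)) 0"
      by (intro isCont_o2[where f = "\<lambda>t. z + of_real t * \<i>" and g = "S (Suc k)"]) auto
    then have "((\<lambda>t. S (Suc k) (z + of_real t * \<i>)) \<longlongrightarrow> S (Suc k) z) (at 0)"
      by (simp add: isCont_def)
    moreover have "eventually (\<lambda>t. S (Suc k) (z + of_real t * \<i>) = 0) (at 0)"
      using near[OF Suc.prems] True unfolding eventually_at_filter
      by (auto elim!: eventually_mono intro!: nonreal)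
    ultimately show ?thesis
      using tendsto_unique[OF trivial_limit_at _ tendsto_eventually] by blast
  qed (use nonreal Suc.prems in auto)
  then show ?case by (simp add: S_def)
qed

section \<open>Several variables\<close>

lemma upd_upd [simp]: "upd (upd y h x) h x' = upd y h x'"
  by (simp add: upd_def vec_eq_iff)

lemma upd_nth [simp]: "upd y h x $ h = x"
  by (simp add: upd_def)

lemma upd_same [simp]: "upd y h (y $ h) = y"
  by (simp add: upd_def vec_eq_iff)

lemma partial_upd: "partial h b g (upd y h x) = pd b (\<lambda>x. g (upd y h x)) x"
  by (simp add: partial_def pd_def along_def[abs_def])

lemma laplacian_upd: "laplacian h g (upd y h x) = lap1 (\<lambda>x. g (upd y h x)) x"
  by (simp add: laplacian_def lap1_def sum_paravec_Basis partial_upd)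

text \<open>Freezing the other variables commutes with the operators as total functions, which
  reduces everything in the h-th variable to one paravector.\<close>

lemma laplacian_power_upd:
  "(\<lambda>x. (laplacian h ^^ k) g (upd y h x)) = (lap1 ^^ k) (\<lambda>x. g (upd y h x))"
  by (induction k) (simp_all add: laplacian_upd)

lemma dbar_upd: "dbar h g (upd y h x) = dbar1 (\<lambda>x. g (upd y h x)) x"
  by (simp add: dbar_def dbar1_def partial_upd)

lemma Ck_in_locally_kernel:
  assumes "\<And>y. y \<in> \<Omega> \<Longrightarrow> (\<lambda>x. g (upd y h x)) \<in> locally_kernel {x. upd y h x \<in> \<Omega>}"
  shows "Ck_in h k \<Omega> g"
  using assms
proof (induction k arbitrary: g)
  case 0
  then show ?case by (simp add: locally_kernel_continuous_on)
next
  case (Suc k)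
  have "along h b g x differentiable at 0" if x: "x \<in> \<Omega>" for b x
  proof -
    have "((\<lambda>s. g (upd x h (x $ h + s *\<^sub>R b))) has_vector_derivative pd b (\<lambda>x'. g (upd x h x')) (x $ h)) (at 0)"
      by (rule bspec[OF locally_kernel_pd(2)[OF Suc.prems[OF x], unfolded has_pd_def]]) (simp add: x)
    then show ?thesis
      unfolding along_def[abs_def] by (rule differentiableI_vector)
  qed
  moreover have "Ck_in h k \<Omega> (partial h b g)" for b
    using locally_kernel_pd(1)[OF Suc.prems] by (intro Suc.IH) (simp add: partial_upd)
  moreover have "Ck_in h 0 \<Omega> g"
    using Suc.prems by (simp add: locally_kernel_continuous_on)
  ultimately show ?case by simp
qed

section \<open>Circular domains and their one-variable sections\<close>

lemma symmetric_dom_iff: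
  assumes "symmetric_dom D" "\<And>l. z' $ l = z $ l \<or> z' $ l = cnj (z $ l)"
  shows "z' \<in> D \<longleftrightarrow> z \<in> D"
proof -
  have *: "z' \<in> D" if z: "z \<in> D" and z': "\<And>l. z' $ l = z $ l \<or> z' $ l = cnj (z $ l)" for z z'
  proof -
    have "(\<chi> l. if l \<in> S then z' $ l else z $ l) \<in> D" (is "?w S \<in> D") if "finite S" for S
      using that
    proof (induction S rule: finite_induct)
      case empty
      then show ?case using z by simp
    next
      case (insert a S)
      have "?w (insert a S) = upd (?w S) a (z' $ a)"
        by (auto simp: vec_eq_iff upd_def)
      moreover have "z' $ a = ?w S $ a \<or> z' $ a = cnj (?w S $ a)"
        using z' insert(2) by simp
      moreover have "upd (?w S) a (cnj (?w S $ a)) \<in> D"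
        using assms(1) insert.IH unfolding symmetric_dom_def by blast
      moreover have "upd (?w S) a (?w S $ a) \<in> D"
        unfolding upd_same by (rule insert.IH)
      ultimately show ?case by metis
    qed
    from this[of UNIV] show ?thesis by simp
  qed
  have "z $ l = z' $ l \<or> z $ l = cnj (z' $ l)" for l
    using assms(2)[of l] by auto
  then show ?thesis using *[of z z'] *[of z' z] assms(2) by blast
qed

abbreviation uppers :: "('m::finite, 'n::finite) pvecs \<Rightarrow> 'n cvecs" where
  "uppers x \<equiv> (\<chi> l. upper (x $ l))"

abbreviation cpoints :: "('n::finite \<Rightarrow> ('m::finite) paravec) \<Rightarrow> 'n cvecs \<Rightarrow> ('m, 'n) pvecs" where
  "cpoints J z \<equiv> (\<chi> l. cpoint (J l) (z $ l))"

lemma upper_cpoint_cases: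
  "J \<in> imag_sphere \<Longrightarrow> upper (cpoint J z) = z \<or> upper (cpoint J z) = cnj z"
  using upper_cpoint[of J z] by (auto simp: complex_eq_iff abs_if)

lemma circ_eq:
  assumes "symmetric_dom D"
  shows "circ D = {x. uppers x \<in> D}"
proof (intro set_eqI iffI)
  fix x assume "x \<in> circ D"
  then obtain J z where x: "x = cpoints J z" "\<forall>l. J l \<in> imag_sphere" "z \<in> D"
    by (auto simp: circ_def)
  have "uppers x \<in> D \<longleftrightarrow> z \<in> D"
    by (rule symmetric_dom_iff[OF assms]) (simp add: x(1) upper_cpoint_cases x(2))
  then show "x \<in> {x. uppers x \<in> D}" using x(3) by simp
next
  fix x assume x: "x \<in> {x. uppers x \<in> D}"
  have "\<forall>l. \<exists>J. J \<in> imag_sphere \<and> x $ l = cpoint J (upper (x $ l))"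
    using paravec_polar by blast
  then obtain J where "\<And>l. J l \<in> imag_sphere" "\<And>l. x $ l = cpoint (J l) (upper (x $ l))"
    by metis
  then have "x = cpoints J (uppers x)" "\<forall>l. J l \<in> imag_sphere" by (auto simp: vec_eq_iff)
  then show "x \<in> circ D" using x unfolding circ_def by blast
qed

definition slice_dom :: "('n::finite) cvecs set \<Rightarrow> 'n \<Rightarrow> 'n cvecs \<Rightarrow> complex set" where
  "slice_dom D h z = {w. upd z h w \<in> D}"

lemma open_slice_dom:
  assumes "open D" shows "open (slice_dom D h z)"
proof -
  have "continuous_on UNIV (upd z h)"
    unfolding upd_def
  proof (intro continuous_on_vec_lambda)
    show "continuous_on UNIV (\<lambda>x. if l = h then x else z $ l)" for l
      by (cases "l = h") (simp_all add: continuous_on_id continuous_on_const)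
  qed
  from open_vimage[OF assms this] show ?thesis by (simp add: slice_dom_def vimage_def)
qed

lemma slice_dom_cong:
  assumes "symmetric_dom D" "\<And>l. z' $ l = z $ l \<or> z' $ l = cnj (z $ l)"
  shows "slice_dom D h z' = slice_dom D h z"
proof -
  have "upd z' h w \<in> D \<longleftrightarrow> upd z h w \<in> D" for w
    by (rule symmetric_dom_iff[OF assms(1)]) (use assms(2) in \<open>auto simp: upd_def\<close>)
  then show ?thesis by (simp add: slice_dom_def)
qed

lemma cnj_slice_dom:
  assumes "symmetric_dom D" shows "cnj ` slice_dom D h z = slice_dom D h z"
proof -
  have iff: "cnj w \<in> slice_dom D h z \<longleftrightarrow> w \<in> slice_dom D h z" for w
    unfolding slice_dom_def mem_Collect_eq
    by (rule symmetric_dom_iff[OF assms]) (auto simp: upd_def)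
  have "w \<in> cnj ` slice_dom D h z" if "w \<in> slice_dom D h z" for w
    by (rule image_eqI[of _ _ "cnj w"]) (simp_all add: iff that)
  then show ?thesis using iff by blast
qed

lemma upd_in_circ:
  assumes "symmetric_dom D"
  shows "upd y h x \<in> circ D \<longleftrightarrow> upper x \<in> slice_dom D h (uppers y)"
proof -
  have "uppers (upd y h x) = upd (uppers y) h (upper x)"
    by (simp add: vec_eq_iff upd_def)
  then show ?thesis by (simp add: circ_eq[OF assms] slice_dom_def)
qed

text \<open>For uniqueness one unit I is enough: \<open>upper (cpoint I w)\<close> is w or its
  conjugate, and both sets are conjugation-invariant. The existential over E in the function classes
  thereby becomes an explicit domain.\<close>

lemma section_of_iff:
  fixes y :: "('m::finite, 'n::finite) pvecs"
  assumes "open D" "symmetric_dom D"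
  shows "section_of D h y E \<longleftrightarrow> E = slice_dom D h (uppers y)"
proof
  let ?S = "slice_dom D h (uppers y)"
  let ?I = "(0, axis undefined 1) :: 'm paravec"
  assume E: "section_of D h y E"
  then have "cnj ` E = E" "(circ1 E :: 'm paravec set) = {x. upper x \<in> ?S}"
    by (auto simp: section_of_def upd_in_circ[OF assms(2)])
  then have "upper (cpoint ?I w) \<in> E \<longleftrightarrow> upper (cpoint ?I w) \<in> ?S" for w
    unfolding circ1_eq[OF \<open>cnj ` E = E\<close>] by blast
  then show "E = ?S"
    using upper_cpoint_in_iff[OF \<open>cnj ` E = E\<close> imag_sphere_nonempty]
      upper_cpoint_in_iff[OF cnj_slice_dom[OF assms(2)] imag_sphere_nonempty] by blast
next
  assume "E = slice_dom D h (uppers y)"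
  then show "section_of D h y E"
    by (simp add: section_of_def open_slice_dom[OF assms(1)] cnj_slice_dom[OF assms(2)]
        circ1_eq[OF cnj_slice_dom[OF assms(2)]] upd_in_circ[OF assms(2)])
qed

lemma slice_regular_in_section:
  fixes f :: "('m::{finite,linorder}, 'n::{finite,linorder}) pvecs \<Rightarrow> 'm clifford"
  assumes "open D" "symmetric_dom D" "f \<in> slice_regular_in h D" "y \<in> circ D"
  shows "slice_regular1 (slice_dom D h (uppers y)) (\<lambda>x. f (upd y h x))"
proof -
  have "\<exists>E. section_of D h y E \<and> slice_regular1 E (\<lambda>x. f (upd y h x))"
    using assms(3,4) unfolding slice_regular_in_def by simp
  then show ?thesis by (simp add: section_of_iff[OF assms(1,2)])
qed

section \<open>Recovering stem functions from values at finitely many units\<close>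

abbreviation jprod :: "('n::{finite,linorder} \<Rightarrow> ('m::{finite,linorder}) paravec) \<Rightarrow> 'n set \<Rightarrow> 'm clifford" where
  "jprod J K \<equiv> cprod_list (map (\<lambda>k. pv (J k)) (sorted_list_of_set K))"

lemma cprod_list_Cons [simp]: "cprod_list (a # as) = a \<odot> cprod_list as"
  by (simp add: cprod_list_def)

lemma cprod_list_Nil [simp]: "cprod_list [] = cunit"
  by (simp add: cprod_list_def)

text \<open>Each unit has inverse \<open>- J k\<close>; the inverses are multiplied in reverse
  order.\<close>

lemma jprod_left_inverse:
  assumes "\<And>k. J k \<in> imag_sphere"
  shows "\<exists>b. \<forall>c. b \<odot> (jprod J K \<odot> c) = c"
proof -
  have "\<exists>b. \<forall>c. b \<odot> (cprod_list (map (\<lambda>k. pv (J k)) ks) \<odot> c) = c" for ks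
  proof (induction ks)
    case Nil
    show ?case by (rule exI[of _ cunit]) simp
  next
    case (Cons k ks)
    then obtain b where "\<forall>c. b \<odot> (cprod_list (map (\<lambda>k. pv (J k)) ks) \<odot> c) = c" by blast
    then show ?case
      by (intro exI[of _ "b \<odot> (- pv (J k))"])
         (simp add: cmul_assoc cmul.minus_left pv_imag_sphere_twice[OF assms])
  qed
  then show ?thesis .
qed

text \<open>The sign (-1)^|T \<inter> K|, a character of the group of sign changes T: negating the
  units in T multiplies the product over K by it.\<close>

definition eps :: "'n::finite set \<Rightarrow> 'n set \<Rightarrow> real" where
  "eps T K = (\<Prod>k\<in>K. if k \<in> T then -1 else 1)"

definition flip :: "('n \<Rightarrow> ('m::finite) paravec) \<Rightarrow> 'n set \<Rightarrow> 'n \<Rightarrow> 'm paravec" where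
  "flip J T k = (if k \<in> T then - J k else J k)"

lemma flip_imag_sphere: "(\<And>k. J k \<in> imag_sphere) \<Longrightarrow> flip J T k \<in> imag_sphere"
  by (simp add: flip_def imag_sphere_uminus)

lemma jprod_flip: "jprod (flip J T) K = eps T K *\<^sub>R jprod J K"
proof -
  have "cprod_list (map (\<lambda>k. pv (flip J T k)) ks) =
    prod_list (map (\<lambda>k. if k \<in> T then -1 else 1) ks) *\<^sub>R cprod_list (map (\<lambda>k. pv (J k)) ks)" for ks
    by (induction ks) (auto simp: flip_def pv_uminus cmul.minus_left cmul.scaleR_right cmul.scaleR_left)
  then show ?thesis
    by (simp add: eps_def prod.distinct_set_conv_list flip: prod.distinct_set_conv_list)
qed

lemma eps_toggle: "eps (sym_diff T {l}) K = (if l \<in> K then - eps T K else eps T K)"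
proof -
  have "eps (sym_diff T {l}) (K - {l}) = eps T (K - {l})"
    unfolding eps_def by (intro prod.cong) auto
  then show ?thesis
    by (cases "l \<in> K") (auto simp: eps_def prod.remove[of K l])
qed

lemma sum_toggle: "(\<Sum>T\<in>UNIV. F (sym_diff T {l})) = (\<Sum>T\<in>UNIV. F (T :: 'n::finite set))"
  by (rule sum.reindex_bij_witness[of _ "\<lambda>T. sym_diff T {l}" "\<lambda>T. sym_diff T {l}"]) auto

text \<open>Orthogonality of characters: toggling in T an element that lies in exactly one of K and
  L negates every summand.\<close>

lemma eps_orthogonal:
  fixes K L :: "'n::finite set"
  shows "(\<Sum>T\<in>UNIV. eps T K * eps T L) = (if K = L then CARD('n set) else 0)"
proof (cases "K = L")
  case True
  have "eps T K * eps T K = 1" for T :: "'n set"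
    unfolding eps_def by (simp flip: prod.distrib) (rule prod.neutral, auto)
  then show ?thesis using True by simp
next
  case False
  then obtain l where l: "l \<in> K \<longleftrightarrow> l \<notin> L" by blast
  have "(\<Sum>T\<in>UNIV. eps T K * eps T L) = (\<Sum>T\<in>UNIV. eps (sym_diff T {l}) K * eps (sym_diff T {l}) L)"
    by (rule sum_toggle[symmetric])
  also have "\<dots> = - (\<Sum>T\<in>UNIV. eps T K * eps T L)"
    using l by (auto simp: eps_toggle sum_negf)
  finally show ?thesis using False by simp
qed

context
  fixes J0 :: "'n::{finite,linorder} \<Rightarrow> ('m::{finite,linorder}) paravec" and B :: "'n set \<Rightarrow> 'm clifford"
  assumes J0: "\<And>k. J0 k \<in> imag_sphere" and B: "\<And>K c. B K \<odot> (jprod J0 K \<odot> c) = c"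
begin

text \<open>The coefficient of a slice function at \<open>\<epsilon>\<^sub>K\<close>, read off its values with units \<open>\<plusminus>J0\<close>.\<close>

definition coeff_of :: "(('m, 'n) pvecs \<Rightarrow> 'm clifford) \<Rightarrow> 'n cvecs \<Rightarrow> 'n set \<Rightarrow> 'm clifford" where
  "coeff_of g z K = (\<Sum>T\<in>UNIV. (eps T K / CARD('n set)) *\<^sub>R (B K \<odot> g (cpoints (flip J0 T) z)))"

text \<open>Fourier inversion over the sign changes isolates the K-th summand, and
  \<open>B K\<close> removes its product of units.\<close>

lemma coeff_of_induced:
  assumes "induces D F f" "z \<in> D"
  shows "coeff_of f z K = F z $ K"
proof -
  have "flip J0 T l \<in> imag_sphere" for T l
    by (rule flip_imag_sphere) (rule J0)
  then have val: "f (cpoints (flip J0 T) z) = (\<Sum>L\<in>UNIV. jprod (flip J0 T) L \<odot> (F z $ L))" for T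
    using assms unfolding induces_def by blast
  have "coeff_of f z K = (\<Sum>T\<in>UNIV. \<Sum>L\<in>UNIV.
      (eps T K * eps T L / CARD('n set)) *\<^sub>R (B K \<odot> (jprod J0 L \<odot> (F z $ L))))"
    by (simp add: coeff_of_def val jprod_flip cmul.sum_right cmul.scaleR_left cmul.scaleR_right scaleR_sum_right)
  also have "\<dots> = (\<Sum>L\<in>UNIV. ((\<Sum>T\<in>UNIV. eps T K * eps T L) / CARD('n set)) *\<^sub>R (B K \<odot> (jprod J0 L \<odot> (F z $ L))))"
    by (subst sum.swap) (simp add: sum_divide_distrib scaleR_left.sum)
  also have "\<dots> = (\<Sum>L\<in>UNIV. if L = K then F z $ K else 0)"
    by (intro sum.cong refl) (auto simp: eps_orthogonal B)
  finally show ?thesis by simp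
qed

text \<open>Conjugating the h-th coordinate amounts to negating the h-th unit, that is, to toggling
  h in T. Reindexing the sum moves this onto the character, which supplies the sign.\<close>

lemma stem_coeff_of: "stem D (\<lambda>z. \<chi> K. coeff_of g z K)"
proof -
  have "cpoints (flip J0 T) (upd z h (cnj (z $ h))) = cpoints (flip J0 (sym_diff T {h})) z" for T z h
    by (auto simp: vec_eq_iff upd_def flip_def cpoint_cnj)
  then have "coeff_of g (upd z h (cnj (z $ h))) K =
      (\<Sum>T\<in>UNIV. (eps T K / CARD('n set)) *\<^sub>R (B K \<odot> g (cpoints (flip J0 (sym_diff T {h})) z)))" for z h K
    by (simp add: coeff_of_def)
  moreover have "\<dots> z h K = (\<Sum>T\<in>UNIV. (eps (sym_diff T {h}) K / CARD('n set)) *\<^sub>R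
      (B K \<odot> g (cpoints (flip J0 (sym_diff (sym_diff T {h}) {h})) z)))" for z h K
    by (rule sum_toggle[symmetric])
  moreover have "sym_diff (sym_diff T {h}) {h} = T" for T and h :: 'n by auto
  ultimately show ?thesis
    by (simp add: stem_def coeff_of_def eps_toggle sum_negf)
qed

end

text \<open>By \<open>coeff_of_induced\<close> the stem function can only be
  \<open>coeff_of\<close>. That it induces the iterated Laplacian is, for fixed z and units J, a
  finite linear relation between restrictions to the h-th variable; it holds for f and is carried
  over by \<open>slice_relation_lap1_power\<close>.\<close>

lemma slice_funs_laplacian_power:
  fixes D :: "('n::{finite,linorder}) cvecs set"
    and f :: "('m::{finite,linorder}, 'n) pvecs \<Rightarrow> 'm clifford"
  assumes D: "open D" "symmetric_dom D" and f: "f \<in> slice_regular_in h D"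
  shows "(laplacian h ^^ k) f \<in> slice_funs D"
proof -
  define g where "g = (laplacian h ^^ k) f"
  define J0 :: "'n \<Rightarrow> 'm paravec" where "J0 = (\<lambda>_. (0, axis undefined 1))"
  have J0: "J0 l \<in> imag_sphere" for l unfolding J0_def by (rule imag_sphere_nonempty)
  obtain B where B: "\<And>K c. B K \<odot> (jprod J0 K \<odot> c) = c"
    using jprod_left_inverse[of J0, OF J0] by metis
  obtain F where F: "induces D F f" using f by (auto simp: slice_regular_in_def slice_funs_def)
  have "g (cpoints J z) = (\<Sum>K\<in>UNIV. jprod J K \<odot> coeff_of J0 B g z K)"
    if z: "z \<in> D" and J: "\<And>l. J l \<in> imag_sphere" for z J
  proof -
    define E where "E = slice_dom D h z"
    \<comment> \<open>\<open>None\<close> stands for the arbitrary units J, \<open>Some T\<close>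
      for the reference units with the signs of T.\<close>
    define I where "I = (\<lambda>p. case p of None \<Rightarrow> J | Some T \<Rightarrow> flip J0 T)"
    define u where "u = (\<lambda>p x. f (upd (cpoints (I p) z) h x))"
    \<comment> \<open>The coefficients of the representation formula with the value at J moved to
      the other side.\<close>
    define c where "c = (\<lambda>p. case p of None \<Rightarrow> - cunit
      | Some T \<Rightarrow> \<Sum>K\<in>UNIV. (eps T K / CARD('n set)) *\<^sub>R (jprod J K \<odot> B K))"
    have I: "I p l \<in> imag_sphere" for p l
      by (simp add: I_def J flip_imag_sphere[OF J0] split: option.split)
    have upd: "upd (cpoints (I p) z) h (cpoint (I p h) w) = cpoints (I p) (upd z h w)" for p w
      by (simp add: vec_eq_iff upd_def)
    have expand: "(\<Sum>p\<in>UNIV. c p \<odot> v (cpoints (I p) w)) =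
        (\<Sum>K\<in>UNIV. jprod J K \<odot> coeff_of J0 B v w K) - v (cpoints J w)" for v w
    proof -
      have "(\<Sum>T\<in>UNIV. c (Some T) \<odot> v (cpoints (flip J0 T) w)) =
          (\<Sum>K\<in>UNIV. jprod J K \<odot> coeff_of J0 B v w K)"
        unfolding coeff_of_def[OF J0 B] c_def
        by (simp add: cmul.sum_left cmul.sum_right cmul.scaleR_left cmul.scaleR_right cmul_assoc)
           (rule sum.swap)
      then show ?thesis
        by (simp add: UNIV_option_conv sum.reindex I_def) (simp add: c_def cmul.minus_left)
    qed
    have reg: "slice_regular1 E (u p)" for p
    proof -
      have "cpoints (I p) z \<in> circ D" using z I unfolding circ_def by blast
      from slice_regular_in_section[OF D f this]
      have "slice_regular1 (slice_dom D h (uppers (cpoints (I p) z))) (u p)" unfolding u_def .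
      \<comment> \<open>Other units change the coordinates of \<open>uppers\<close> at most by
        conjugation, so all restrictions share the domain \<open>E\<close>.\<close>
      moreover have "slice_dom D h (uppers (cpoints (I p) z)) = E"
        unfolding E_def by (rule slice_dom_cong[OF D(2)]) (simp add: upper_cpoint_cases I)
      ultimately show ?thesis by simp
    qed
    have "(\<Sum>p\<in>UNIV. c p \<odot> u p (cpoint (I p h) w)) = 0" if "w \<in> E" for w
    proof -
      have w: "upd z h w \<in> D" using that by (simp add: E_def slice_dom_def)
      have "f (cpoints J (upd z h w)) = (\<Sum>K\<in>UNIV. jprod J K \<odot> (F (upd z h w) $ K))"
        using F w J unfolding induces_def by blast
      then show ?thesis
        unfolding u_def upd expand by (simp add: coeff_of_induced[OF J0 B F w])
    qed
    then have "(\<Sum>p\<in>UNIV. c p \<odot> (lap1 ^^ k) (u p) (cpoint (I p h) (z $ h))) = 0"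
      using z reg I open_slice_dom[OF D(1), of h z] cnj_slice_dom[OF D(2), of h z]
      by (intro slice_relation_lap1_power[where E = E]) (simp_all add: E_def slice_dom_def)
    moreover have "(lap1 ^^ k) (u p) (cpoint (I p h) (z $ h)) = g (cpoints (I p) z)" for p
      unfolding u_def laplacian_power_upd[symmetric] upd g_def by simp
    ultimately show ?thesis using expand[of g z] by simp
  qed
  then have "induces D (\<lambda>z. \<chi> K. coeff_of J0 B g z K) g"
    by (simp add: induces_def)
  then show ?thesis
    using stem_coeff_of[OF J0 B] unfolding slice_funs_def g_def by blast
qed

theorem theorem5p3:
  fixes D :: "('n::{finite,linorder}) cvecs set"
    and h :: 'n
    and f :: "('m::{finite,linorder}, 'n) pvecs \<Rightarrow> 'm clifford"
    and \<gamma> :: nat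
  assumes "odd CARD('m)"
    and "\<gamma> = (CARD('m) - 1) div 2"
    and "open D"
    and "symmetric_dom D"
    and "f \<in> slice_regular_in h D"
  shows "Ck_in h (2 * \<gamma>) (circ D) f \<and>
         (laplacian h ^^ \<gamma>) f \<in> axially_monogenic_in h D \<and>
         (laplacian h ^^ \<gamma>) f \<in> slice_in h D \<and>
         (\<forall>x\<in>circ D. dbar h ((laplacian h ^^ \<gamma>) f) x = 0) \<and>
         (laplacian h ^^ \<gamma>) \<in>
           (slice_regular_in h D :: (('m, 'n) pvecs \<Rightarrow> 'm clifford) set) \<rightarrow> axially_monogenic_in h D"
proof -
  note D = assms(3,4)
  have reg: "slice_regular1 (slice_dom D h (uppers y)) (\<lambda>x. f (upd y h x))"
    if "f \<in> slice_regular_in h D" "y \<in> circ D" for f :: "('m, 'n) pvecs \<Rightarrow> 'm clifford" and y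
    using slice_regular_in_section[OF D that] .
  \<comment> \<open>All orders and all powers at once: this covers both the smoothness of f that
    makes the iterated Laplacian meaningful and the \<open>C^1\<close> part of monogenicity.\<close>
  have Ck: "Ck_in h k (circ D) ((laplacian h ^^ j) f)"
    if "f \<in> slice_regular_in h D" for f :: "('m, 'n) pvecs \<Rightarrow> 'm clifford" and j k
    unfolding upd_in_circ[OF D(2)]
    by (rule Ck_in_locally_kernel, unfold laplacian_power_upd upd_in_circ[OF D(2)],
        rule lap1_power_locally_kernel[OF open_slice_dom[OF D(1)] cnj_slice_dom[OF D(2)] reg[OF that]])
  have slice: "(laplacian h ^^ \<gamma>) f \<in> slice_in h D"
    if f: "f \<in> slice_regular_in h D" for f :: "('m, 'n) pvecs \<Rightarrow> 'm clifford"
    using slice_funs_laplacian_power[OF D f]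
      slice1_lap1_power[OF open_slice_dom[OF D(1)] cnj_slice_dom[OF D(2)] reg[OF f]]
    by (auto simp: slice_in_def section_of_iff[OF D] laplacian_power_upd)
  have dbar: "dbar h ((laplacian h ^^ \<gamma>) f) x = 0"
    if f: "f \<in> slice_regular_in h D" and x: "x \<in> circ D" for f :: "('m, 'n) pvecs \<Rightarrow> 'm clifford" and x
  proof -
    \<comment> \<open>The kernel exponent starts at 1, so after \<gamma> Laplacians it is \<gamma> +
      1 = (m + 1)/2, the monogenic one.\<close>
    have "CARD('m) = 2 * \<gamma> + 1" using assms(1,2) by presburger
    moreover have "upper (x $ h) \<in> slice_dom D h (uppers x)"
      using x upd_in_circ[OF D(2), of x h "x $ h"] by simp
    ultimately have "dbar1 ((lap1 ^^ \<gamma>) (\<lambda>x'. f (upd x h x'))) (x $ h) = 0"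
      by (rule dbar1_lap1_power[OF open_slice_dom[OF D(1)] cnj_slice_dom[OF D(2)] reg[OF f x]])
    then show ?thesis
      using dbar_upd[of h "(laplacian h ^^ \<gamma>) f" x "x $ h"] by (simp add: laplacian_power_upd)
  qed
  have "(laplacian h ^^ \<gamma>) f \<in> axially_monogenic_in h D"
    if "f \<in> slice_regular_in h D" for f :: "('m, 'n) pvecs \<Rightarrow> 'm clifford"
    unfolding axially_monogenic_in_def monogenic_in_def
    using slice[OF that] Ck[OF that, of 1 \<gamma>] dbar[OF that] by blast
  then show ?thesis
    using slice[OF assms(5)] Ck[OF assms(5), of "2 * \<gamma>" 0] dbar[OF assms(5)] assms(5) by auto
qed

end
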